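(* For the discrete auto-bidding problem and the algorithm $\textsf{Learn-Alg}$ described in the context, with confidence parameter $\delta$ of the learning phase, the competitive ratio satisfies $$\mu_{\textsf{Learn-Alg}}\ \ge\ \frac12-O\!\left(\frac{K\log(1/\delta)}{\sqrt{T}}\right),$$ and $\textsf{Learn-Alg}$ satisfies the return-on-spend constraint (ROSC) with probability $1-O\!\left(\frac{K\log(1/\delta)}{\sqrt{T}}\right)$.
   Context: Discrete auto-bidding with threshold functions. There are $T$ slots. In slot $t$ a pair $(v_t,\theta_t)$ is drawn i.i.d. from an unknown distribution $\mathcal{D}$, with $\theta_t\in[0,1]$ and $v_t$ taking $K$ possible values $\mathsf{v}_1>\dots>\mathsf{v}_K$, $\mathsf{v}_1\le 1$, with probabilities $p_1,\dots,p_K$ independent of $T$; $K$, the values and the probabilities are unknown to the algorithm. The algorithm sees $v_t$ and bids $b_t$; if $b_t\ge\theta_t$ the allocation is $x_t(b_t)=1$ and the payment is $p_t(b_t)=\theta_t$, otherwise both are $0$. After the bid the outcome of the auction (allocation function and required payment) is received. The ROSC is $\mathbb{E}\{\sum_{t=1}^T p_t(b_t)\}\le\mathbb{E}\{\sum_{t=1}^T v_t x_t(b_t)\}$. $\mathsf{OPT}$ maximizes $\mathbb{E}\{\sum_{t=1}^T v_t x_t(b_t)\}$ subject to the ROSC, knowing $\mathcal{D}$. The competitive ratio of an algorithm $\mathcal{A}$ is $\mu_{\mathcal{A}}=\min_{\mathcal{D}}\frac{\mathbb{E}\{\sum_{t=1}^T v_t x_t(b_t^{\mathcal{A}})\}}{\mathbb{E}\{\sum_{t=1}^T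 v_t x_t(b_t^{\mathsf{OPT}})\}}$. Parameters: $\ell_k=\mathbb{E}\{\mathsf{v}_k-\theta_t\mid v_t=\mathsf{v}_k,\theta_t\le\mathsf{v}_k\}$, $r_k=\mathbb{E}\{\theta_t-\mathsf{v}_k\mid v_t=\mathsf{v}_k,\theta_t>\mathsf{v}_k\}$, $\overleftarrow{w}_k=\mathbb{P}(\theta_t\le v_t\mid v_t=\mathsf{v}_k)$, $\overrightarrow{w}_k=\mathbb{P}(\theta_t>v_t\mid v_t=\mathsf{v}_k)$. Let (LP) be: maximize $\sum_{k=1}^K p_k\overleftarrow{w}_k\mathsf{v}_k+\sum_{k=1}^K p_k\overrightarrow{w}_k\mathsf{v}_k q_k$ over $0\le q_k\le1$ subject to $\sum_{k=1}^K p_k\overrightarrow{w}_k r_k q_k\le\sum_{k=1}^K p_k\overleftarrow{w}_k\ell_k$. Its optimal solution has a threshold $\sigma^\star$ with $q_k=1$ if $\mathsf{v}_k/r_k>\sigma^\star$, $q_k=0$ if $\mathsf{v}_k/r_k<\sigma^\star$, and $q_k$ possibly fractional (making the constraint tight) if $\mathsf{v}_k/r_k=\sigma^\star$. $\textsf{Learn-Alg}$: Learning phase, slots $t=1,\dots,T/2$: bid $b_t=v_t$; let $\hat K$ be the number of distinct values of $v_t$ observed, and estimate each of $p_k,\overleftarrow{w}_k,\overrightarrow{w}_k,r_k,\ell_k$ by its sample mean $\frac1n\sum_{i=1}^n X_i$. With the estimated parameters (and $K=\hat K$), compute $\sigma^\star$ and the fractional $q_k$ of (LP). Decision phase, slots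 $t>T/2$: when $v_t=\mathsf{v}_k$, bid $b_t=1$ if $\mathsf{v}_k/r_k>\sigma^\star$; bid $b_t=1$ with probability $q_k$ (and $b_t=v_t$ otherwise) if $\mathsf{v}_k/r_k=\sigma^\star$; bid $b_t=v_t$ if $\mathsf{v}_k/r_k<\sigma^\star$. Here $\delta\in(0,1)$ is the confidence parameter: each parameter estimate is within $O(\log(1/\delta)/\sqrt{T})$ of its true value except with probability at most $\delta$. The probability with which the ROSC is satisfied refers to the randomness of the learning phase.
   Formalization: OPT is restricted to bids at most the value or at least 1 (the LP benchmark), as the ratio claim fails against arbitrary bids; the minimum runs over distributions with positive parameters at least η, for T large depending on K, η and a bound on δ below 1, as uniformity over all fails. *)

theory Defs
  imports "HOL-Probability.Probability"
begin

section \<open>Instances\<close>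

text \<open>
  A distribution of \<open>(v, \<theta>)\<close> is a probability measure on \<open>real \<times> real\<close>.  Since the \<open>K\<close> possible
  values are distinct, the parameters are indexed by the value \<open>v\<close> instead of by its rank \<open>k\<close>.
\<close>

definition val_prob :: "(real \<times> real) measure \<Rightarrow> real \<Rightarrow> real" where
  "val_prob D v = \<P>(z in D. fst z = v)"

definition vals :: "(real \<times> real) measure \<Rightarrow> real set" where
  "vals D = {v. val_prob D v > 0}"

definition auction_dist :: "nat \<Rightarrow> (real \<times> real) measure \<Rightarrow> bool" where
  "auction_dist K D \<longleftrightarrow>
     prob_space D \<and> sets D = sets borel \<and>
     finite (vals D) \<and> card (vals D) = K \<and> vals D \<subseteq> {0..1} \<and>
     (AE z in D. fst z \<in> vals D \<and> snd z \<in> {0..1})"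

definition w_left :: "(real \<times> real) measure \<Rightarrow> real \<Rightarrow> real" where
  "w_left D v = \<P>(z in D. snd z \<le> fst z \<bar> fst z = v)"

definition w_right :: "(real \<times> real) measure \<Rightarrow> real \<Rightarrow> real" where
  "w_right D v = \<P>(z in D. snd z > fst z \<bar> fst z = v)"

definition gain :: "(real \<times> real) measure \<Rightarrow> real \<Rightarrow> real" where
  "gain D v = (\<integral>z. v - snd z \<partial>uniform_measure D {z. fst z = v \<and> snd z \<le> v})"

text \<open>
  The \<open>O\<close>-constants hide a dependence on the instance, which is fixed while \<open>T\<close> grows: no bound is
  uniform over all distributions (e.g. if \<open>P(\<theta> \<le> v)\<close> is of order \<open>1/T\<close>, the learning phase
  sees no profitable slot with constant probability).  The infimum defining the competitive ratio
  is therefore taken over the classes below, in which the positive parameters are bounded away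
  from \<open>0\<close>; their union over \<open>\<eta> > 0\<close> consists of all instances.
\<close>

definition instances :: "nat \<Rightarrow> real \<Rightarrow> (real \<times> real) measure set" where
  "instances K \<eta> =
     {D. auction_dist K D \<and>
         (\<forall>v\<in>vals D. \<forall>x\<in>{v, val_prob D v, w_left D v, w_right D v, gain D v}. x > 0 \<longrightarrow> x \<ge> \<eta>)}"

lemma auction_dist_in_instances:
  assumes "auction_dist K D"
  shows "\<exists>\<eta>>0. D \<in> instances K \<eta>"
proof -
  define X where
    "X = (\<Union>v\<in>vals D. {v, val_prob D v, w_left D v, w_right D v, gain D v}) \<inter> {0<..}"
  have fin: "finite (insert 1 X)"
    using assms by (auto simp: X_def auction_dist_def)
  have "Min (insert 1 X) > 0"
    using fin by (subst Min_gr_iff) (auto simp: X_def)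
  moreover have "Min (insert 1 X) \<le> x"
    if "v \<in> vals D" "x \<in> {v, val_prob D v, w_left D v, w_right D v, gain D v}" "x > 0" for v x
  proof (rule Min_le[OF fin])
    show "x \<in> insert 1 X" unfolding X_def using that by blast
  qed
  ultimately show ?thesis
    using assms unfolding instances_def by blast
qed


section \<open>Bidding policies\<close>

text \<open>
  A slot outcome is \<open>((v, \<theta>), u)\<close>, where \<open>u\<close> is the private randomness of the bidder, uniform on
  \<open>[0,1]\<close> and independent of \<open>(v, \<theta>)\<close>.  The bid \<open>\<pi> t h v u\<close> in slot \<open>t\<close> (slots are
  \<open>0, \<dots>, T - 1\<close>) depends on the history \<open>h\<close> of the slots before \<open>t\<close>, the current value \<open>v\<close> and
  the current \<open>u\<close>.  The history contains the past \<open>\<theta>\<close> even of lost slots, as the whole allocation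
  function is received after the bid.
\<close>

type_synonym slot = "(real \<times> real) \<times> real"
type_synonym policy = "nat \<Rightarrow> (nat \<Rightarrow> slot) \<Rightarrow> real \<Rightarrow> real \<Rightarrow> real"

definition is_policy :: "nat \<Rightarrow> policy \<Rightarrow> bool" where
  "is_policy T \<pi> \<longleftrightarrow>
     (\<forall>t<T. (\<lambda>(h, v, u). \<pi> t h v u)
        \<in> borel_measurable ((\<Pi>\<^sub>M i\<in>{..<t}. (borel :: slot measure)) \<Otimes>\<^sub>M borel \<Otimes>\<^sub>M borel))"

definition slots :: "(real \<times> real) measure \<Rightarrow> nat set \<Rightarrow> (nat \<Rightarrow> slot) measure" where
  "slots D I = (\<Pi>\<^sub>M t\<in>I. D \<Otimes>\<^sub>M uniform_measure lborel {0..1})"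

definition bid :: "policy \<Rightarrow> (nat \<Rightarrow> slot) \<Rightarrow> nat \<Rightarrow> real" where
  "bid \<pi> \<omega> t = \<pi> t (restrict \<omega> {..<t}) (fst (fst (\<omega> t))) (snd (\<omega> t))"

definition alloc :: "real \<Rightarrow> real \<Rightarrow> real" where
  "alloc \<theta> b = (if b \<ge> \<theta> then 1 else 0)"

definition pay :: "real \<Rightarrow> real \<Rightarrow> real" where
  "pay \<theta> b = (if b \<ge> \<theta> then \<theta> else 0)"

definition total_value :: "nat \<Rightarrow> policy \<Rightarrow> (nat \<Rightarrow> slot) \<Rightarrow> real" where
  "total_value T \<pi> \<omega> = (\<Sum>t<T. fst (fst (\<omega> t)) * alloc (snd (fst (\<omega> t))) (bid \<pi> \<omega> t))"

definition total_payment :: "nat \<Rightarrow> policy \<Rightarrow> (nat \<Rightarrow> slot) \<Rightarrow> real" where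
  "total_payment T \<pi> \<omega> = (\<Sum>t<T. pay (snd (fst (\<omega> t))) (bid \<pi> \<omega> t))"

definition exp_value :: "(real \<times> real) measure \<Rightarrow> nat \<Rightarrow> policy \<Rightarrow> real" where
  "exp_value D T \<pi> = (\<integral>\<omega>. total_value T \<pi> \<omega> \<partial>slots D {..<T})"

definition exp_payment :: "(real \<times> real) measure \<Rightarrow> nat \<Rightarrow> policy \<Rightarrow> real" where
  "exp_payment D T \<pi> = (\<integral>\<omega>. total_payment T \<pi> \<omega> \<partial>slots D {..<T})"

definition rosc :: "(real \<times> real) measure \<Rightarrow> nat \<Rightarrow> policy \<Rightarrow> bool" where
  "rosc D T \<pi> \<longleftrightarrow> exp_payment D T \<pi> \<le> exp_value D T \<pi>"

text \<open>
  \<open>rosc_given D T n \<pi> h\<close> is the ROSC for the expectations over all \<open>T\<close> slots conditioned on the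
  outcome \<open>h\<close> of the first \<open>n\<close> slots.
\<close>

definition rosc_given :: "(real \<times> real) measure \<Rightarrow> nat \<Rightarrow> nat \<Rightarrow> policy \<Rightarrow> (nat \<Rightarrow> slot) \<Rightarrow> bool" where
  "rosc_given D T n \<pi> h \<longleftrightarrow>
     (\<integral>\<omega>. total_payment T \<pi> (merge {..<n} {n..<T} (h, \<omega>)) \<partial>slots D {n..<T})
     \<le> (\<integral>\<omega>. total_value T \<pi> (merge {..<n} {n..<T} (h, \<omega>)) \<partial>slots D {n..<T})"


section \<open>Benchmark and competitive ratio\<close>

text \<open>
  The benchmark is the one described by the linear program below, where \<open>q v\<close> is the probability
  of bidding \<open>1\<close> instead of \<open>v\<close>: bids strictly between the value and \<open>1\<close> are excluded.  This
  matters: a benchmark with unrestricted bids can exceed every policy that only bids \<open>v\<close> or \<open>1\<close>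
  by an arbitrarily large factor.
\<close>

definition benchmark_policy :: "nat \<Rightarrow> policy \<Rightarrow> bool" where
  "benchmark_policy T \<pi> \<longleftrightarrow>
     is_policy T \<pi> \<and> (\<forall>t<T. \<forall>h v u. \<pi> t h v u \<le> v \<or> \<pi> t h v u \<ge> 1)"

definition OPT :: "(real \<times> real) measure \<Rightarrow> nat \<Rightarrow> real" where
  "OPT D T = (SUP \<pi>\<in>{\<pi>. benchmark_policy T \<pi> \<and> rosc D T \<pi>}. exp_value D T \<pi>)"

text \<open>Distributions with \<open>OPT = 0\<close>, whose ratio would be \<open>0/0\<close>, are left out.\<close>

definition competitive_ratio :: "(real \<times> real) measure set \<Rightarrow> nat \<Rightarrow> policy \<Rightarrow> ereal" where
  "competitive_ratio \<D> T \<pi> = (INF D\<in>{D\<in>\<D>. OPT D T > 0}. ereal (exp_value D T \<pi> / OPT D T))"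


section \<open>The linear program\<close>

record lp_params =
  V :: "real set"
  p :: "real \<Rightarrow> real"
  wl :: "real \<Rightarrow> real"
  wr :: "real \<Rightarrow> real"
  r :: "real \<Rightarrow> real"
  l :: "real \<Rightarrow> real"

definition lp_objective :: "lp_params \<Rightarrow> (real \<Rightarrow> real) \<Rightarrow> real" where
  "lp_objective P q =
     (\<Sum>v\<in>V P. p P v * wl P v * v) + (\<Sum>v\<in>V P. p P v * wr P v * v * q v)"

definition lp_feasible :: "lp_params \<Rightarrow> (real \<Rightarrow> real) \<Rightarrow> bool" where
  "lp_feasible P q \<longleftrightarrow>
     (\<forall>v\<in>V P. 0 \<le> q v \<and> q v \<le> 1) \<and>
     (\<Sum>v\<in>V P. p P v * wr P v * r P v * q v) \<le> (\<Sum>v\<in>V P. p P v * wl P v * l P v)"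

definition lp_optimal :: "lp_params \<Rightarrow> (real \<Rightarrow> real) \<Rightarrow> bool" where
  "lp_optimal P q \<longleftrightarrow>
     lp_feasible P q \<and> (\<forall>q'. lp_feasible P q' \<longrightarrow> lp_objective P q' \<le> lp_objective P q)"

text \<open>
  The comparison of \<open>v / r v\<close> with \<open>\<sigma>\<close> is multiplied out, so that a positive value with \<open>r v = 0\<close>
  has infinite ratio; division by zero in HOL would give ratio \<open>0\<close>.
\<close>

definition lp_threshold :: "lp_params \<Rightarrow> real \<Rightarrow> (real \<Rightarrow> real) \<Rightarrow> bool" where
  "lp_threshold P \<sigma> q \<longleftrightarrow>
     (\<forall>v\<in>V P. (v > \<sigma> * r P v \<longrightarrow> q v = 1) \<and> (v < \<sigma> * r P v \<longrightarrow> q v = 0))"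


section \<open>Learn-Alg\<close>

text \<open>The mean of an empty sample is \<open>0\<close>.\<close>

definition sample_mean :: "nat set \<Rightarrow> (nat \<Rightarrow> real) \<Rightarrow> real" where
  "sample_mean I X = (\<Sum>i\<in>I. X i) / real (card I)"

definition estimates :: "nat \<Rightarrow> (nat \<Rightarrow> real \<times> real) \<Rightarrow> lp_params" where
  "estimates n z =
     \<lparr> V = (\<lambda>i. fst (z i)) ` {..<n},
       p = (\<lambda>v. sample_mean {..<n} (\<lambda>i. of_bool (fst (z i) = v))),
       wl = (\<lambda>v. sample_mean {i\<in>{..<n}. fst (z i) = v} (\<lambda>i. of_bool (snd (z i) \<le> v))),
       wr = (\<lambda>v. sample_mean {i\<in>{..<n}. fst (z i) = v} (\<lambda>i. of_bool (snd (z i) > v))),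
       r = (\<lambda>v. sample_mean {i\<in>{..<n}. fst (z i) = v \<and> snd (z i) > v} (\<lambda>i. snd (z i) - v)),
       l = (\<lambda>v. sample_mean {i\<in>{..<n}. fst (z i) = v \<and> snd (z i) \<le> v} (\<lambda>i. v - snd (z i))) \<rparr>"

text \<open>
  Neither \<open>\<sigma>\<close> nor, in case of ties, \<open>q\<close> is unique.  Hence the algorithm is parametrised by an
  arbitrary rule computing them from the estimates.
\<close>

definition lp_solver :: "nat \<Rightarrow> (lp_params \<Rightarrow> real \<times> (real \<Rightarrow> real)) \<Rightarrow> bool" where
  "lp_solver n solve \<longleftrightarrow>
     (\<forall>z. case solve (estimates n z) of (\<sigma>, q) \<Rightarrow>
        lp_optimal (estimates n z) q \<and> lp_threshold (estimates n z) \<sigma> q)"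

text \<open>
  A value that did not occur in the learning phase has no estimates; the policy then bids \<open>v\<close>.
\<close>

definition learn_alg :: "(lp_params \<Rightarrow> real \<times> (real \<Rightarrow> real)) \<Rightarrow> nat \<Rightarrow> policy" where
  "learn_alg solve T t h v u =
     (if t < T div 2 then v
      else let P = estimates (T div 2) (\<lambda>i. fst (h i)); (\<sigma>, q) = solve P in
        if v \<notin> V P then v
        else if v > \<sigma> * r P v then 1
        else if v = \<sigma> * r P v then (if u < q v then 1 else v)
        else v)"

end

theory Submission imports Defs begin

text \<open>
  Learn-Alg has a constant factor to spare: it truthfully bids its value in the first half, which
  earns at least the truthful surplus \<open>s = E (v - \<theta>)\<^sup>+\<close> per slot, both in value and in slack for the
  ROSC.  In the class \<open>instances K \<eta>\<close> either \<open>s = 0\<close>, in which case the ROSC forbids winning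
  above one's value, or \<open>s \<ge> \<eta>\<^sup>3\<close>.  In the latter case, as soon as the estimates are accurate up to
  some constant \<open>\<epsilon>(\<eta>, K)\<close>, the errors of the decision phase are absorbed by the learning phase: the
  ROSC holds and the ratio is at least \<open>1/2\<close> outright.  By Hoeffding's inequality inaccurate
  estimates have probability \<open>O(1/T)\<close>, which is eventually below \<open>K log(1/\<delta>) / sqrt T\<close> uniformly
  in \<open>\<delta> \<le> \<delta>\<^sub>0\<close>.
  The benchmark is at most \<open>T\<close> times the value of the linear program, because the averaged
  probabilities of bidding high form a feasible point.
\<close>

section \<open>One slot\<close>

text \<open>The estimates of \<open>wl\<close>, \<open>wr\<close>, \<open>r\<close> and
  \<open>l\<close> are means over samples of random size, awkward to control one by one. Up to an
  additive constant in the objective, however, the program depends only on the products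
  \<open>p * wr\<close>, \<open>p * wr * r\<close> and \<open>p * wl * l\<close>, and their
  estimates telescope to plain averages over all n learning slots. Summing the last product over the
  values, only 2K + 1 averages of fixed length have to concentrate. Repairing the feasibility of a
  perturbed point costs a factor 1/s, hence the dichotomy on s; the cube arises because s is a sum
  of products of three parameters. When s = 0 approximation cannot help, as any expected overpayment
  breaks the ROSC; but then the estimated surplus is exactly 0 almost surely. The spare factor: let
  B be the extra value per slot of the benchmark over truthful bidding, whose value per slot is b.
  The benchmark earns at most T (b + B), Learn-Alg about T b + (T/2) B. Twice the latter exceeds the
  former by about T b, which is at least T s.\<close>

lemma borel_measurable_fst [measurable (raw)]:
  fixes f :: "'c \<Rightarrow> 'a::topological_space \<times> 'b::topological_space"
  shows "f \<in> M \<rightarrow>\<^sub>M borel \<Longrightarrow> (\<lambda>x. fst (f x)) \<in> M \<rightarrow>\<^sub>M borel"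
  by (rule measurable_compose[OF _ borel_measurable_continuous_onI]) (auto intro: continuous_intros)

lemma borel_measurable_snd [measurable (raw)]:
  fixes f :: "'c \<Rightarrow> 'a::topological_space \<times> 'b::topological_space"
  shows "f \<in> M \<rightarrow>\<^sub>M borel \<Longrightarrow> (\<lambda>x. snd (f x)) \<in> M \<rightarrow>\<^sub>M borel"
  by (rule measurable_compose[OF _ borel_measurable_continuous_onI]) (auto intro: continuous_intros)

locale auction =
  fixes K :: nat and D :: "(real \<times> real) measure"
  assumes D: "auction_dist K D"
begin

abbreviation U :: "real measure" where "U \<equiv> uniform_measure lborel {0..1}"

abbreviation slot_dist :: "slot measure" where "slot_dist \<equiv> D \<Otimes>\<^sub>M U"

sublocale D: prob_space D
  using D by (simp add: auction_dist_def)

sublocale U: prob_space U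
  by (rule prob_space_uniform_measure) auto

sublocale DU: pair_prob_space D U ..

sublocale PS: product_prob_space "\<lambda>_. slot_dist" UNIV ..

lemma sets_D [simp, measurable_cong]: "sets D = sets borel"
  using D by (simp add: auction_dist_def)

lemma space_D [simp]: "space D = UNIV"
  using sets_eq_imp_space_eq[OF sets_D] by simp

lemma sets_slot_dist [simp, measurable_cong]: "sets slot_dist = sets borel"
proof -
  have "sets slot_dist = sets (borel \<Otimes>\<^sub>M borel)"
    by (intro sets_pair_measure_cong) auto
  then show ?thesis by (simp only: borel_prod)
qed

lemma space_slot_dist [simp]: "space slot_dist = UNIV"
  using sets_eq_imp_space_eq[OF sets_slot_dist] by simp

lemma sets_slots [measurable_cong]: "sets (slots D I) = sets (\<Pi>\<^sub>M i\<in>I. (borel :: slot measure))"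
  unfolding slots_def by (intro sets_PiM_cong sets_slot_dist refl)

lemma prob_space_slots: "prob_space (slots D I)"
  unfolding slots_def by (intro prob_space_PiM) unfold_locales

lemma finite_vals: "finite (vals D)" and card_vals: "card (vals D) = K"
  using D by (auto simp: auction_dist_def)

lemma vals_range: "v \<in> vals D \<Longrightarrow> 0 \<le> v \<and> v \<le> 1"
  using D by (auto simp: auction_dist_def)

lemma K_pos: "K > 0"
proof (rule ccontr)
  assume "\<not> K > 0"
  then have "vals D = {}" using finite_vals card_vals by auto
  then have "AE z in D. False" using D by (auto simp: auction_dist_def)
  then show False by simp
qed

text \<open>Turns the almost sure range conditions into one pointwise predicate, so that
  integrability reduces to a bound on typical outcomes.\<close>

definition typical :: "real \<times> real \<Rightarrow> bool" where
  "typical z \<longleftrightarrow> fst z \<in> vals D \<and> 0 \<le> snd z \<and> snd z \<le> 1"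

lemma AE_typical: "AE z in D. typical z"
  using D by (auto simp: auction_dist_def typical_def)

lemma measurable_typical [measurable]: "Measurable.pred borel typical"
proof -
  have "Measurable.pred borel (\<lambda>z::real \<times> real. (\<exists>v\<in>vals D. fst z = v) \<and> 0 \<le> snd z \<and> snd z \<le> 1)"
    using finite_vals by measurable
  then show ?thesis by (simp add: typical_def[abs_def])
qed

lemma AE_slot_typical: "AE y in slot_dist. typical (fst y)"
proof (rule DU.AE_pair_measure)
  have "Measurable.pred slot_dist (\<lambda>y. typical (fst y))" by measurable
  then show "{y \<in> space slot_dist. typical (fst y)} \<in> sets slot_dist"
    by (rule predE)
qed (use AE_typical in auto)

lemma integrable_bounded_D:
  assumes "f \<in> borel_measurable borel" "\<And>z. typical z \<Longrightarrow> \<bar>f z\<bar> \<le> (B::real)"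
  shows "integrable D f"
  using assms AE_typical
  by (intro D.integrable_const_bound[where B = B]) auto

lemma integrable_bounded_slot:
  assumes "f \<in> borel_measurable borel" "\<And>y. typical (fst y) \<Longrightarrow> \<bar>f y\<bar> \<le> (B::real)"
  shows "integrable slot_dist f"
  using assms AE_slot_typical
  by (intro DU.integrable_const_bound[where B = B]) auto

text \<open>On the event that the value is \<open>v\<close>, the factor \<beta> depends on the
  private randomness alone, which is independent of the auction, so Fubini splits the integral into
  a product.\<close>

lemma integral_split_vals:
  assumes f: "f \<in> borel_measurable borel" "\<And>z. typical z \<Longrightarrow> \<bar>f z\<bar> \<le> (B::real)"
    and \<beta>: "(\<lambda>(v, u). \<beta> v u) \<in> borel_measurable (borel \<Otimes>\<^sub>M borel)"
      "\<And>v u. 0 \<le> \<beta> v u \<and> \<beta> v u \<le> (1::real)"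
  shows "(\<integral>y. f (fst y) * \<beta> (fst (fst y)) (snd y) \<partial>slot_dist) =
    (\<Sum>v\<in>vals D. (\<integral>z. of_bool (fst z = v) * f z \<partial>D) * (\<integral>u. \<beta> v u \<partial>U))"
proof -
  let ?F = "\<lambda>v y. (of_bool (fst (fst y) = v) * f (fst y)) * \<beta> v (snd y)"
  note [measurable] = f(1)
  have [measurable]: "(\<lambda>u. \<beta> v u) \<in> borel_measurable borel" for v
    using measurable_compose[OF _ \<beta>(1), of "\<lambda>u. (v, u)" borel] by simp
  have [measurable]: "(\<lambda>y::slot. \<beta> (fst (fst y)) (snd y)) \<in> borel_measurable borel"
    using measurable_compose[OF _ \<beta>(1), of "\<lambda>y::slot. (fst (fst y), snd y)" borel] by simp
  have B: "0 \<le> B" if "typical z" for z using f(2)[OF that] by linarith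
  have bound: "\<bar>?F v y\<bar> \<le> B" if "typical (fst y)" for v y
  proof -
    have "\<bar>?F v y\<bar> = of_bool (fst (fst y) = v) * \<bar>f (fst y)\<bar> * \<beta> v (snd y)"
      using \<beta>(2)[of v "snd y"] by (simp add: abs_mult)
    also have "\<dots> \<le> 1 * B * 1"
      using \<beta>(2)[of v "snd y"] f(2)[OF that] B[OF that] by (intro mult_mono) auto
    finally show ?thesis by simp
  qed
  have int: "integrable slot_dist (?F v)" for v
    by (rule integrable_bounded_slot[OF _ bound]) auto
  have meas: "(\<lambda>y. f (fst y) * \<beta> (fst (fst y)) (snd y)) \<in> borel_measurable slot_dist"
    by measurable
  have "(\<integral>y. f (fst y) * \<beta> (fst (fst y)) (snd y) \<partial>slot_dist) = (\<integral>y. (\<Sum>v\<in>vals D. ?F v y) \<partial>slot_dist)"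
  proof (rule integral_cong_AE[OF meas])
    show "(\<lambda>y. \<Sum>v\<in>vals D. ?F v y) \<in> borel_measurable slot_dist" by measurable
    show "AE y in slot_dist. f (fst y) * \<beta> (fst (fst y)) (snd y) = (\<Sum>v\<in>vals D. ?F v y)"
      using AE_slot_typical
    proof eventually_elim
      case (elim y)
      have "(\<Sum>v\<in>vals D. ?F v y) = (\<Sum>v\<in>vals D. if v = fst (fst y) then f (fst y) * \<beta> v (snd y) else 0)"
        by (intro sum.cong) auto
      then show ?case using elim finite_vals by (simp add: typical_def)
    qed
  qed
  also have "\<dots> = (\<Sum>v\<in>vals D. \<integral>y. ?F v y \<partial>slot_dist)"
    using int by (rule Bochner_Integration.integral_sum)
  also have "\<dots> = (\<Sum>v\<in>vals D. (\<integral>z. of_bool (fst z = v) * f z \<partial>D) * (\<integral>u. \<beta> v u \<partial>U))"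
  proof (intro sum.cong refl)
    fix v
    have "(\<integral>y. ?F v y \<partial>slot_dist) = (\<integral>z. (\<integral>u. (of_bool (fst z = v) * f z) * \<beta> v u \<partial>U) \<partial>D)"
      using DU.integral_fst'[OF int[of v]] by simp
    then show "(\<integral>y. ?F v y \<partial>slot_dist) = (\<integral>z. of_bool (fst z = v) * f z \<partial>D) * (\<integral>u. \<beta> v u \<partial>U)"
      by simp
  qed
  finally show ?thesis .
qed

text \<open>This and the next three definitions are the data of the true linear program written as
  unconditional expectations: in the notation of (LP), the constant of the objective, the right-hand
  side of the constraint, \<open>p * wr\<close> and \<open>p * wr * r\<close>. Null conditioning
  events then need no care.\<close>

definition base_value :: real where
  "base_value = (\<integral>z. fst z * of_bool (snd z \<le> fst z) \<partial>D)"

definition surplus :: real where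
  "surplus = (\<integral>z. max 0 (fst z - snd z) \<partial>D)"

definition extra_prob :: "real \<Rightarrow> real" where
  "extra_prob v = (\<integral>z. of_bool (fst z = v \<and> snd z > v) \<partial>D)"

definition extra_cost :: "real \<Rightarrow> real" where
  "extra_cost v = (\<integral>z. of_bool (fst z = v \<and> snd z > v) * (snd z - v) \<partial>D)"

lemma extra_prob_bounds: "0 \<le> extra_prob v" "extra_prob v \<le> 1"
proof -
  show "0 \<le> extra_prob v" unfolding extra_prob_def by simp
  have "extra_prob v \<le> (\<integral>z. 1 \<partial>D)" unfolding extra_prob_def
    by (intro integral_mono integrable_bounded_D[where B = 1]) auto
  then show "extra_prob v \<le> 1" by (simp add: D.prob_space[simplified])
qed

lemma extra_cost_nonneg: "0 \<le> extra_cost v"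
  unfolding extra_cost_def by (intro integral_nonneg_AE AE_I2) auto

text \<open>At value 1 the truthful bid is already a bid of 1 and counts as high; the vanishing
  coefficient makes this ambiguity harmless.\<close>

lemma extra_prob_one:
  assumes "v \<ge> 1"
  shows "extra_prob v = 0"
proof -
  have "AE z in D. of_bool (fst z = v \<and> snd z > v) = (0::real)"
    using AE_typical by eventually_elim (use assms in \<open>auto simp: typical_def\<close>)
  then show ?thesis unfolding extra_prob_def by (rule integral_eq_zero_AE)
qed

lemma extra_prob_eq_0_iff: "extra_prob v = 0 \<longleftrightarrow> (AE z in D. \<not> (fst z = v \<and> snd z > v))"
  unfolding extra_prob_def
  by (subst integral_nonneg_eq_0_iff_AE) (auto intro!: integrable_bounded_D[where B = 1])

text \<open>The overpayment is strictly positive wherever \<theta> exceeds the value. Hence, with no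
  surplus to spend, no extra value can be bought either.\<close>

lemma extra_cost_eq_0_iff: "extra_cost v = 0 \<longleftrightarrow> extra_prob v = 0"
proof -
  have "integrable D (\<lambda>z. of_bool (fst z = v \<and> snd z > v) * (snd z - v))"
    by (rule integrable_bounded_D[where B = "1 + \<bar>v\<bar>"]) (auto simp: typical_def)
  then have "extra_cost v = 0 \<longleftrightarrow>
      (AE z in D. of_bool (fst z = v \<and> snd z > v) * (snd z - v) = 0)"
    unfolding extra_cost_def by (rule integral_nonneg_eq_0_iff_AE) auto
  also have "\<dots> \<longleftrightarrow> extra_prob v = 0"
    unfolding extra_prob_eq_0_iff by (rule AE_cong) auto
  finally show ?thesis .
qed

lemma surplus_nonneg: "0 \<le> surplus"
  unfolding surplus_def by (intro integral_nonneg_AE AE_I2) auto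

lemma typicalD: "typical z \<Longrightarrow> 0 \<le> fst z \<and> fst z \<le> 1 \<and> 0 \<le> snd z \<and> snd z \<le> 1"
  using vals_range by (auto simp: typical_def)

lemma surplus_le_base_value: "surplus \<le> base_value"
  unfolding surplus_def base_value_def
  by (intro integral_mono_AE integrable_bounded_D[where B = 1] eventually_mono[OF AE_typical])
     (auto dest!: typicalD)

lemma surplus_eq_0_iff: "surplus = 0 \<longleftrightarrow> (AE z in D. max 0 (fst z - snd z) = 0)"
proof -
  have "integrable D (\<lambda>z. max 0 (fst z - snd z))"
    by (rule integrable_bounded_D[where B = 1]) (auto dest!: typicalD)
  then show ?thesis
    unfolding surplus_def by (rule integral_nonneg_eq_0_iff_AE) auto
qed

definition value_at :: "slot \<Rightarrow> real \<Rightarrow> real" where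
  "value_at y b = fst (fst y) * alloc (snd (fst y)) b"

definition pay_at :: "slot \<Rightarrow> real \<Rightarrow> real" where
  "pay_at y b = pay (snd (fst y)) b"

text \<open>The outcome of a bid \<open>b\<close> when \<open>b = v\<close> or \<open>b = 1\<close>, and an upper bound when \<open>b \<le> v\<close> or \<open>b \<ge> 1\<close>.\<close>

definition lp_value_at :: "slot \<Rightarrow> real \<Rightarrow> real" where
  "lp_value_at y b = fst (fst y) * of_bool (snd (fst y) \<le> fst (fst y)) +
     (fst (fst y) * of_bool (snd (fst y) > fst (fst y))) * of_bool (b \<ge> 1)"

definition lp_surplus_at :: "slot \<Rightarrow> real \<Rightarrow> real" where
  "lp_surplus_at y b = max 0 (fst (fst y) - snd (fst y)) -
     (of_bool (snd (fst y) > fst (fst y)) * (snd (fst y) - fst (fst y))) * of_bool (b \<ge> 1)"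

lemma value_at_le: "typical (fst y) \<Longrightarrow> b \<le> fst (fst y) \<or> b \<ge> 1 \<Longrightarrow> value_at y b \<le> lp_value_at y b"
  and surplus_at_le: "typical (fst y) \<Longrightarrow> b \<le> fst (fst y) \<or> b \<ge> 1 \<Longrightarrow>
    value_at y b - pay_at y b \<le> lp_surplus_at y b"
  and value_at_eq: "typical (fst y) \<Longrightarrow> b = fst (fst y) \<or> b = 1 \<Longrightarrow> value_at y b = lp_value_at y b"
  and surplus_at_eq: "typical (fst y) \<Longrightarrow> b = fst (fst y) \<or> b = 1 \<Longrightarrow>
    value_at y b - pay_at y b = lp_surplus_at y b"
  by (auto dest!: typicalD
      simp: value_at_def lp_value_at_def lp_surplus_at_def pay_at_def alloc_def pay_def max_def)

lemma abs_at_le: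
  assumes "typical (fst y)"
  shows "\<bar>value_at y b\<bar> \<le> 1" "\<bar>pay_at y b\<bar> \<le> 1" "\<bar>lp_value_at y b\<bar> \<le> 1" "\<bar>lp_surplus_at y b\<bar> \<le> 1"
  using typicalD[OF assms]
  by (auto simp: value_at_def lp_value_at_def lp_surplus_at_def pay_at_def alloc_def pay_def max_def)

lemma measurable_at [measurable (raw)]:
  assumes [measurable]: "f \<in> M \<rightarrow>\<^sub>M (borel :: slot measure)" "g \<in> borel_measurable M"
  shows "(\<lambda>x. value_at (f x) (g x)) \<in> borel_measurable M"
    and "(\<lambda>x. pay_at (f x) (g x)) \<in> borel_measurable M"
    and "(\<lambda>x. lp_value_at (f x) (g x)) \<in> borel_measurable M"
    and "(\<lambda>x. lp_surplus_at (f x) (g x)) \<in> borel_measurable M"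
  unfolding value_at_def pay_at_def lp_value_at_def lp_surplus_at_def alloc_def pay_def
  by measurable

text \<open>The variable \<open>q v\<close> of the linear program that the one-slot strategy \<beta>
  realises.\<close>

definition high_prob :: "(real \<Rightarrow> real \<Rightarrow> real) \<Rightarrow> real \<Rightarrow> real" where
  "high_prob \<beta> v = (\<integral>u. of_bool (\<beta> v u \<ge> 1) \<partial>U)"

lemma high_prob_bounds: "0 \<le> high_prob \<beta> v" "high_prob \<beta> v \<le> 1"
proof -
  show "0 \<le> high_prob \<beta> v" unfolding high_prob_def by simp
  show "high_prob \<beta> v \<le> 1"
  \<comment> \<open>No measurability of \<beta> is assumed here; a non-integrable function has
    integral 0 by convention.\<close>
  proof (cases "integrable U (\<lambda>u. of_bool (\<beta> v u \<ge> 1) :: real)")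
    case True
    then have "high_prob \<beta> v \<le> (\<integral>u. 1 \<partial>U)"
      unfolding high_prob_def by (intro integral_mono) auto
    then show ?thesis by (simp add: U.prob_space[simplified])
  qed (simp add: high_prob_def not_integrable_integral_eq)
qed

context
  fixes \<beta> :: "real \<Rightarrow> real \<Rightarrow> real"
  assumes \<beta>: "(\<lambda>(v, u). \<beta> v u) \<in> borel_measurable (borel \<Otimes>\<^sub>M borel)"
begin

private lemma high_measurable:
  "(\<lambda>(v, u). of_bool (\<beta> v u \<ge> 1) :: real) \<in> borel_measurable (borel \<Otimes>\<^sub>M borel)"
  using \<beta> by measurable

private lemma slot_high_measurable [measurable]:
  "(\<lambda>y::slot. \<beta> (fst (fst y)) (snd y)) \<in> borel_measurable borel"
  using measurable_compose[OF _ \<beta>, of "\<lambda>y::slot. (fst (fst y), snd y)" borel] by simp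

text \<open>Linearity in the probabilities of high bids is the point: it is the objective of the
  program, and averaging over histories passes through it.\<close>

lemma expectation_lp_value_at:
  "(\<integral>y. lp_value_at y (\<beta> (fst (fst y)) (snd y)) \<partial>slot_dist) =
     base_value + (\<Sum>v\<in>vals D. v * extra_prob v * high_prob \<beta> v)"
proof -
  let ?f = "\<lambda>z::real \<times> real. fst z * of_bool (snd z > fst z)"
  let ?b = "\<lambda>y::slot. of_bool (\<beta> (fst (fst y)) (snd y) \<ge> 1) :: real"
  have "(\<integral>y. lp_value_at y (\<beta> (fst (fst y)) (snd y)) \<partial>slot_dist) =
      (\<integral>y. fst (fst y) * of_bool (snd (fst y) \<le> fst (fst y)) \<partial>slot_dist) +
      (\<integral>y. ?f (fst y) * ?b y \<partial>slot_dist)"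
    unfolding lp_value_at_def
    by (intro Bochner_Integration.integral_add integrable_bounded_slot[where B = 1])
       (auto dest!: typicalD)
  also have "(\<integral>y. fst (fst y) * of_bool (snd (fst y) \<le> fst (fst y)) \<partial>slot_dist) = base_value"
  proof -
    have "integrable slot_dist (\<lambda>y. fst (fst y) * of_bool (snd (fst y) \<le> fst (fst y)))"
      by (rule integrable_bounded_slot[where B = 1]) (auto dest!: typicalD)
    from DU.integral_fst'[OF this] show ?thesis
      by (simp add: base_value_def U.prob_space[simplified])
  qed
  also have "(\<integral>y. ?f (fst y) * ?b y \<partial>slot_dist) =
      (\<Sum>v\<in>vals D. (\<integral>z. of_bool (fst z = v) * ?f z \<partial>D) * high_prob \<beta> v)"
    unfolding high_prob_def
    by (rule integral_split_vals[where B = 1, OF _ _ high_measurable]) (auto dest!: typicalD)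
  also have "\<dots> = (\<Sum>v\<in>vals D. v * extra_prob v * high_prob \<beta> v)"
  proof (intro sum.cong refl)
    fix v
    have "(\<integral>z. of_bool (fst z = v) * ?f z \<partial>D) = (\<integral>z. v * of_bool (fst z = v \<and> snd z > v) \<partial>D)"
      by (intro Bochner_Integration.integral_cong) auto
    then show "(\<integral>z. of_bool (fst z = v) * ?f z \<partial>D) * high_prob \<beta> v = v * extra_prob v * high_prob \<beta> v"
      by (simp add: extra_prob_def)
  qed
  finally show ?thesis .
qed

lemma expectation_lp_surplus_at:
  "(\<integral>y. lp_surplus_at y (\<beta> (fst (fst y)) (snd y)) \<partial>slot_dist) =
     surplus - (\<Sum>v\<in>vals D. extra_cost v * high_prob \<beta> v)"
proof -
  let ?f = "\<lambda>z::real \<times> real. of_bool (snd z > fst z) * (snd z - fst z)"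
  let ?b = "\<lambda>y::slot. of_bool (\<beta> (fst (fst y)) (snd y) \<ge> 1) :: real"
  have "(\<integral>y. lp_surplus_at y (\<beta> (fst (fst y)) (snd y)) \<partial>slot_dist) =
      (\<integral>y. max 0 (fst (fst y) - snd (fst y)) \<partial>slot_dist) -
      (\<integral>y. ?f (fst y) * ?b y \<partial>slot_dist)"
    unfolding lp_surplus_at_def
    by (intro Bochner_Integration.integral_diff integrable_bounded_slot[where B = 1])
       (auto dest!: typicalD)
  also have "(\<integral>y. max 0 (fst (fst y) - snd (fst y)) \<partial>slot_dist) = surplus"
  proof -
    have "integrable slot_dist (\<lambda>y. max 0 (fst (fst y) - snd (fst y)))"
      by (rule integrable_bounded_slot[where B = 1]) (auto dest!: typicalD)
    from DU.integral_fst'[OF this] show ?thesis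
      by (simp add: surplus_def U.prob_space[simplified])
  qed
  also have "(\<integral>y. ?f (fst y) * ?b y \<partial>slot_dist) =
      (\<Sum>v\<in>vals D. (\<integral>z. of_bool (fst z = v) * ?f z \<partial>D) * high_prob \<beta> v)"
    unfolding high_prob_def
    by (rule integral_split_vals[where B = 1, OF _ _ high_measurable]) (auto dest!: typicalD)
  also have "\<dots> = (\<Sum>v\<in>vals D. extra_cost v * high_prob \<beta> v)"
  proof (intro sum.cong refl)
    fix v
    have "(\<integral>z. of_bool (fst z = v) * ?f z \<partial>D) = extra_cost v"
      unfolding extra_cost_def by (intro Bochner_Integration.integral_cong) auto
    then show "(\<integral>z. of_bool (fst z = v) * ?f z \<partial>D) * high_prob \<beta> v = extra_cost v * high_prob \<beta> v"
      by simp
  qed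
  finally show ?thesis .
qed

end

end

section \<open>Policies and concentration\<close>

context auction
begin

lemma measurable_slots_component [measurable]:
  "t \<in> I \<Longrightarrow> (\<lambda>\<omega>. \<omega> t) \<in> slots D I \<rightarrow>\<^sub>M borel"
  using measurable_component_singleton[of t I "\<lambda>_. borel :: slot measure"]
  by (simp add: measurable_cong_sets[OF sets_slots refl])

lemma AE_slots_typical:
  assumes "finite I"
  shows "AE \<omega> in slots D I. \<forall>t\<in>I. typical (fst (\<omega> t))"
proof (rule AE_finite_allI[OF assms])
  fix t assume "t \<in> I"
  then show "AE \<omega> in slots D I. typical (fst (\<omega> t))"
    unfolding slots_def using AE_slot_typical by (intro AE_PiM_component) (auto, unfold_locales)
qed

lemma integrable_bounded_slots:
  assumes "finite I" "f \<in> borel_measurable (slots D I)"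
    "\<And>\<omega>. (\<And>t. t \<in> I \<Longrightarrow> typical (fst (\<omega> t))) \<Longrightarrow> \<bar>f \<omega>\<bar> \<le> (B::real)"
  shows "integrable (slots D I) f"
proof -
  interpret S: prob_space "slots D I" by (rule prob_space_slots)
  show ?thesis using AE_slots_typical[OF assms(1)] assms(2,3)
    by (intro S.integrable_const_bound[where B = B]) (auto elim!: eventually_mono)
qed

lemma integral_slots_insert:
  fixes f :: "(nat \<Rightarrow> slot) \<Rightarrow> real"
  assumes "finite I" "t \<in> I" "integrable (slots D I) f"
  shows "(\<integral>\<omega>. f \<omega> \<partial>slots D I) = (\<integral>x. (\<integral>y. f (x(t := y)) \<partial>slot_dist) \<partial>slots D (I - {t}))"
  using PS.product_integral_insert[of "I - {t}" t f] assms
  by (simp add: slots_def insert_absorb)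

lemma integral_slots_component:
  fixes f :: "slot \<Rightarrow> real"
  assumes "t \<in> I" "f \<in> borel_measurable borel"
  shows "(\<integral>\<omega>. f (\<omega> t) \<partial>slots D I) = (\<integral>y. f y \<partial>slot_dist)"
proof -
  have "(\<integral>y. f y \<partial>slot_dist) = (\<integral>y. f y \<partial>distr (slots D I) slot_dist (\<lambda>\<omega>. \<omega> t))"
    unfolding slots_def by (subst distr_PiM_component[OF _ assms(1)]) (auto, unfold_locales)
  also have "\<dots> = (\<integral>\<omega>. f (\<omega> t) \<partial>slots D I)"
    using assms measurable_slots_component[OF assms(1)]
    by (subst integral_distr) (auto simp: measurable_cong_sets[OF sets_slot_dist refl] measurable_cong_sets[OF refl sets_slot_dist])
  finally show ?thesis ..
qed

section \<open>Bids of a policy and their averaged probabilities of being high\<close>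

lemma measurable_restrict_slots:
  assumes "J \<subseteq> I"
  shows "(\<lambda>\<omega>. restrict \<omega> J) \<in> slots D I \<rightarrow>\<^sub>M (\<Pi>\<^sub>M i\<in>J. (borel :: slot measure))"
  using assms by (intro measurable_restrict measurable_slots_component) auto

lemma measurable_policy:
  assumes "is_policy T \<pi>" "t < T"
    "f \<in> M \<rightarrow>\<^sub>M (\<Pi>\<^sub>M i\<in>{..<t}. (borel :: slot measure))"
    "g \<in> borel_measurable M" "k \<in> borel_measurable M"
  shows "(\<lambda>x. \<pi> t (f x) (g x) (k x)) \<in> borel_measurable M"
proof -
  have 1: "(\<lambda>(h, v, u). \<pi> t h v u)
      \<in> borel_measurable ((\<Pi>\<^sub>M i\<in>{..<t}. (borel :: slot measure)) \<Otimes>\<^sub>M borel \<Otimes>\<^sub>M borel)"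
    using assms by (auto simp: is_policy_def)
  have 2: "(\<lambda>x. (f x, g x, k x))
      \<in> M \<rightarrow>\<^sub>M (\<Pi>\<^sub>M i\<in>{..<t}. (borel :: slot measure)) \<Otimes>\<^sub>M borel \<Otimes>\<^sub>M borel"
    using assms by measurable
  show ?thesis using measurable_compose[OF 2 1] by simp
qed

lemma measurable_policy_section:
  assumes "is_policy T \<pi>" "t < T" "h \<in> space (\<Pi>\<^sub>M i\<in>{..<t}. (borel :: slot measure))"
  shows "(\<lambda>(v, u). \<pi> t h v u) \<in> borel_measurable (borel \<Otimes>\<^sub>M borel)"
  unfolding case_prod_beta'
  by (rule measurable_policy[OF assms(1,2)]) (use assms(3) in auto)

lemma measurable_bid:
  assumes "is_policy T \<pi>" "t < T" "{..t} \<subseteq> I"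
  shows "(\<lambda>\<omega>. bid \<pi> \<omega> t) \<in> borel_measurable (slots D I)"
proof -
  have [measurable]: "(\<lambda>\<omega>. \<omega> t) \<in> slots D I \<rightarrow>\<^sub>M borel"
    using assms by auto
  show ?thesis unfolding bid_def using assms(3)
    by (intro measurable_policy[OF assms(1,2)] measurable_restrict_slots) auto
qed

definition history_high_prob :: "policy \<Rightarrow> nat \<Rightarrow> (nat \<Rightarrow> slot) \<Rightarrow> real \<Rightarrow> real" where
  "history_high_prob \<pi> t \<omega> = high_prob (\<pi> t (restrict \<omega> {..<t}))"

text \<open>The average runs over all other slots, later ones included, although only earlier ones
  influence the bid: this is the outer integral that remains once slot \<open>t\<close> is
  integrated out first.\<close>

definition mean_high_prob :: "nat \<Rightarrow> policy \<Rightarrow> nat \<Rightarrow> real \<Rightarrow> real" where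
  "mean_high_prob T \<pi> t v = (\<integral>\<omega>. history_high_prob \<pi> t \<omega> v \<partial>slots D ({..<T} - {t}))"

context
  fixes T :: nat and \<pi> :: policy and t :: nat
  assumes \<pi>: "is_policy T \<pi>" and t: "t < T"
begin

lemma integrable_history_high_prob:
  "integrable (slots D ({..<T} - {t})) (\<lambda>\<omega>. history_high_prob \<pi> t \<omega> v)"
proof -
  let ?S = "slots D ({..<T} - {t})"
  have [measurable]: "(\<lambda>x. \<pi> t (restrict (fst x) {..<t}) v (snd x)) \<in> borel_measurable (?S \<Otimes>\<^sub>M U)"
    by (intro measurable_policy[OF \<pi> t] measurable_compose[OF measurable_fst measurable_restrict_slots])
       (use t in auto)
  have "(\<lambda>\<omega>. \<integral>u. of_bool (\<pi> t (restrict \<omega> {..<t}) v u \<ge> 1) \<partial>U :: real) \<in> borel_measurable ?S"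
    by measurable
  then show ?thesis unfolding history_high_prob_def high_prob_def
    using high_prob_bounds[of "\<pi> t (restrict _ {..<t})" v]
    by (intro integrable_bounded_slots[where B = 1]) (auto simp: high_prob_def)
qed

lemma mean_high_prob_bounds: "0 \<le> mean_high_prob T \<pi> t v" "mean_high_prob T \<pi> t v \<le> 1"
proof -
  interpret S: prob_space "slots D ({..<T} - {t})" by (rule prob_space_slots)
  show "0 \<le> mean_high_prob T \<pi> t v"
    unfolding mean_high_prob_def history_high_prob_def
    by (intro integral_nonneg_AE AE_I2 high_prob_bounds)
  have "mean_high_prob T \<pi> t v \<le> (\<integral>\<omega>. 1 \<partial>slots D ({..<T} - {t}))"
    unfolding mean_high_prob_def
    by (intro integral_mono integrable_history_high_prob)
       (auto simp: history_high_prob_def high_prob_bounds)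
  then show "mean_high_prob T \<pi> t v \<le> 1" by (simp add: S.prob_space)
qed

private lemma bid_meas: "(\<lambda>\<omega>. bid \<pi> \<omega> t) \<in> borel_measurable (slots D {..<T})"
  using t by (intro measurable_bid[OF \<pi> t]) auto

text \<open>For a fixed history the bid is a one-slot strategy, to which \<open>c\<close> applies.
  Since the result is affine in \<open>high_prob\<close>, integrating over the history only replaces
  these probabilities by their means.\<close>

private lemma expectation_slot_bid:
  assumes F: "(\<lambda>\<omega>. F (\<omega> t) (bid \<pi> \<omega> t)) \<in> borel_measurable (slots D {..<T})"
    "\<And>y b. typical (fst y) \<Longrightarrow> \<bar>F y b\<bar> \<le> (1::real)"
    and c: "\<And>\<beta>. (\<lambda>(v, u). \<beta> v u) \<in> borel_measurable (borel \<Otimes>\<^sub>M borel) \<Longrightarrow>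
      (\<integral>y. F y (\<beta> (fst (fst y)) (snd y)) \<partial>slot_dist) = a + (\<Sum>v\<in>vals D. c v * high_prob \<beta> v)"
  shows "(\<integral>\<omega>. F (\<omega> t) (bid \<pi> \<omega> t) \<partial>slots D {..<T}) =
    a + (\<Sum>v\<in>vals D. c v * mean_high_prob T \<pi> t v)"
proof -
  let ?S = "slots D ({..<T} - {t})"
  interpret S: prob_space ?S by (rule prob_space_slots)
  have r: "restrict (x(t := y)) {..<t} = restrict x {..<t}" for x :: "nat \<Rightarrow> slot" and y
    by (auto simp: fun_eq_iff)
  have "(\<integral>\<omega>. F (\<omega> t) (bid \<pi> \<omega> t) \<partial>slots D {..<T}) =
      (\<integral>\<omega>. (\<integral>y. F y (\<pi> t (restrict \<omega> {..<t}) (fst (fst y)) (snd y)) \<partial>slot_dist) \<partial>?S)"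
  proof (subst integral_slots_insert[of _ t])
    show "integrable (slots D {..<T}) (\<lambda>\<omega>. F (\<omega> t) (bid \<pi> \<omega> t))"
      using t by (intro integrable_bounded_slots[where B = 1] F) auto
  qed (use t in \<open>auto simp: bid_def r\<close>)
  also have "\<dots> = (\<integral>\<omega>. a + (\<Sum>v\<in>vals D. c v * history_high_prob \<pi> t \<omega> v) \<partial>?S)"
  proof (intro Bochner_Integration.integral_cong refl)
    fix \<omega> assume "\<omega> \<in> space ?S"
    then have "restrict \<omega> {..<t} \<in> space (\<Pi>\<^sub>M i\<in>{..<t}. (borel :: slot measure))"
      by (rule measurable_space[OF measurable_restrict_slots[of _ "{..<T} - {t}"], rotated]) (use t in auto)
    from measurable_policy_section[OF \<pi> t this]
    show "(\<integral>y. F y (\<pi> t (restrict \<omega> {..<t}) (fst (fst y)) (snd y)) \<partial>slot_dist) =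
        a + (\<Sum>v\<in>vals D. c v * history_high_prob \<pi> t \<omega> v)"
      unfolding history_high_prob_def by (rule c)
  qed
  also have "\<dots> = a + (\<Sum>v\<in>vals D. c v * mean_high_prob T \<pi> t v)"
    unfolding mean_high_prob_def using integrable_history_high_prob
    by (subst Bochner_Integration.integral_add)
       (auto intro!: Bochner_Integration.integrable_sum simp: S.prob_space)
  finally show ?thesis .
qed

lemma expectation_lp_value_bid:
  "(\<integral>\<omega>. lp_value_at (\<omega> t) (bid \<pi> \<omega> t) \<partial>slots D {..<T}) =
     base_value + (\<Sum>v\<in>vals D. v * extra_prob v * mean_high_prob T \<pi> t v)"
  using bid_meas t
  by (intro expectation_slot_bid expectation_lp_value_at abs_at_le measurable_at
      measurable_slots_component) auto

lemma expectation_lp_surplus_bid: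
  "(\<integral>\<omega>. lp_surplus_at (\<omega> t) (bid \<pi> \<omega> t) \<partial>slots D {..<T}) =
     surplus - (\<Sum>v\<in>vals D. extra_cost v * mean_high_prob T \<pi> t v)"
proof -
  have "(\<integral>\<omega>. lp_surplus_at (\<omega> t) (bid \<pi> \<omega> t) \<partial>slots D {..<T}) =
     surplus + (\<Sum>v\<in>vals D. - extra_cost v * mean_high_prob T \<pi> t v)"
    using bid_meas t
    by (intro expectation_slot_bid abs_at_le measurable_at measurable_slots_component)
       (auto simp: expectation_lp_surplus_at sum_negf)
  then show ?thesis by (simp add: sum_negf)
qed

lemma integrable_at_bid:
  shows "integrable (slots D {..<T}) (\<lambda>\<omega>. value_at (\<omega> t) (bid \<pi> \<omega> t))"
    and "integrable (slots D {..<T}) (\<lambda>\<omega>. pay_at (\<omega> t) (bid \<pi> \<omega> t))"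
    and "integrable (slots D {..<T}) (\<lambda>\<omega>. lp_value_at (\<omega> t) (bid \<pi> \<omega> t))"
    and "integrable (slots D {..<T}) (\<lambda>\<omega>. lp_surplus_at (\<omega> t) (bid \<pi> \<omega> t))"
  using bid_meas t
  by (auto intro!: integrable_bounded_slots[where B = 1] abs_at_le measurable_at
      measurable_slots_component)

end

section \<open>Totals of a policy, bounded by the linear program\<close>

lemma total_value_eq: "total_value T \<pi> \<omega> = (\<Sum>t<T. value_at (\<omega> t) (bid \<pi> \<omega> t))"
  by (simp add: total_value_def value_at_def)

lemma total_payment_eq: "total_payment T \<pi> \<omega> = (\<Sum>t<T. pay_at (\<omega> t) (bid \<pi> \<omega> t))"
  by (simp add: total_payment_def pay_at_def)

lemma exp_value_eq_sum:
  assumes "is_policy T \<pi>"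
  shows "exp_value D T \<pi> = (\<Sum>t<T. \<integral>\<omega>. value_at (\<omega> t) (bid \<pi> \<omega> t) \<partial>slots D {..<T})"
  unfolding exp_value_def total_value_eq
  by (intro Bochner_Integration.integral_sum integrable_at_bid[OF assms]) simp

lemma exp_payment_eq_sum:
  assumes "is_policy T \<pi>"
  shows "exp_payment D T \<pi> = (\<Sum>t<T. \<integral>\<omega>. pay_at (\<omega> t) (bid \<pi> \<omega> t) \<partial>slots D {..<T})"
  unfolding exp_payment_def total_payment_eq
  by (intro Bochner_Integration.integral_sum integrable_at_bid[OF assms]) simp

definition total_high_prob :: "nat \<Rightarrow> policy \<Rightarrow> real \<Rightarrow> real" where
  "total_high_prob T \<pi> v = (\<Sum>t<T. mean_high_prob T \<pi> t v)"

lemma total_high_prob_bounds: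
  assumes "is_policy T \<pi>"
  shows "0 \<le> total_high_prob T \<pi> v" "total_high_prob T \<pi> v \<le> T"
proof -
  show "0 \<le> total_high_prob T \<pi> v"
    unfolding total_high_prob_def by (intro sum_nonneg mean_high_prob_bounds[OF assms]) auto
  have "total_high_prob T \<pi> v \<le> (\<Sum>t<T. 1)"
    unfolding total_high_prob_def by (intro sum_mono mean_high_prob_bounds[OF assms]) auto
  then show "total_high_prob T \<pi> v \<le> T" by simp
qed

lemma sum_mean_high_prob:
  "(\<Sum>t<T. \<Sum>v\<in>vals D. c v * mean_high_prob T \<pi> t v) = (\<Sum>v\<in>vals D. c v * total_high_prob T \<pi> v)"
  unfolding total_high_prob_def sum_distrib_left by (rule sum.swap)

text \<open>Only an inequality, since a bid below the value may lose slots that a truthful bid wins.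
  A bid of at least 1 almost surely wins and so acts like a bid of 1.\<close>

lemma exp_value_le:
  assumes "benchmark_policy T \<pi>"
  shows "exp_value D T \<pi> \<le> T * base_value + (\<Sum>v\<in>vals D. v * extra_prob v * total_high_prob T \<pi> v)"
proof -
  have pol: "is_policy T \<pi>" and b: "\<And>t h v u. t < T \<Longrightarrow> \<pi> t h v u \<le> v \<or> \<pi> t h v u \<ge> 1"
    using assms by (auto simp: benchmark_policy_def)
  have "exp_value D T \<pi> \<le> (\<Sum>t<T. \<integral>\<omega>. lp_value_at (\<omega> t) (bid \<pi> \<omega> t) \<partial>slots D {..<T})"
    unfolding exp_value_eq_sum[OF pol]
  proof (intro sum_mono integral_mono_AE)
    fix t assume "t \<in> {..<T}"
    then show "AE \<omega> in slots D {..<T}. value_at (\<omega> t) (bid \<pi> \<omega> t) \<le> lp_value_at (\<omega> t) (bid \<pi> \<omega> t)"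
      using b by (intro eventually_mono[OF AE_slots_typical[of "{..<T}"]] value_at_le) (auto simp: bid_def)
  qed (auto intro: integrable_at_bid[OF pol])
  also have "\<dots> = (\<Sum>t<T. base_value + (\<Sum>v\<in>vals D. v * extra_prob v * mean_high_prob T \<pi> t v))"
    by (intro sum.cong refl expectation_lp_value_bid[OF pol]) auto
  finally show ?thesis
    by (simp add: sum.distrib sum_mean_high_prob)
qed

lemma exp_value_eq:
  assumes pol: "is_policy T \<pi>" and b: "\<And>t h v u. t < T \<Longrightarrow> \<pi> t h v u = v \<or> \<pi> t h v u = 1"
  shows "exp_value D T \<pi> = (\<Sum>t<T. base_value + (\<Sum>v\<in>vals D. v * extra_prob v * mean_high_prob T \<pi> t v))"
proof -
  have "exp_value D T \<pi> = (\<Sum>t<T. \<integral>\<omega>. lp_value_at (\<omega> t) (bid \<pi> \<omega> t) \<partial>slots D {..<T})"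
    unfolding exp_value_eq_sum[OF pol]
  proof (intro sum.cong refl integral_cong_AE)
    fix t assume "t \<in> {..<T}"
    then show "AE \<omega> in slots D {..<T}. value_at (\<omega> t) (bid \<pi> \<omega> t) = lp_value_at (\<omega> t) (bid \<pi> \<omega> t)"
      using b by (intro eventually_mono[OF AE_slots_typical[of "{..<T}"]] value_at_eq) (auto simp: bid_def)
  qed (auto intro!: borel_measurable_integrable integrable_at_bid[OF pol])
  also have "\<dots> = (\<Sum>t<T. base_value + (\<Sum>v\<in>vals D. v * extra_prob v * mean_high_prob T \<pi> t v))"
    by (intro sum.cong refl expectation_lp_value_bid[OF pol]) auto
  finally show ?thesis .
qed

text \<open>Underbidding can only forgo profitable slots. Combined with the ROSC, this makes the
  averaged probabilities of high bids feasible for the true program.\<close>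

lemma exp_surplus_le:
  assumes "benchmark_policy T \<pi>"
  shows "exp_value D T \<pi> - exp_payment D T \<pi> \<le>
    T * surplus - (\<Sum>v\<in>vals D. extra_cost v * total_high_prob T \<pi> v)"
proof -
  have pol: "is_policy T \<pi>" and b: "\<And>t h v u. t < T \<Longrightarrow> \<pi> t h v u \<le> v \<or> \<pi> t h v u \<ge> 1"
    using assms by (auto simp: benchmark_policy_def)
  have "exp_value D T \<pi> - exp_payment D T \<pi> =
      (\<Sum>t<T. \<integral>\<omega>. value_at (\<omega> t) (bid \<pi> \<omega> t) - pay_at (\<omega> t) (bid \<pi> \<omega> t) \<partial>slots D {..<T})"
    unfolding exp_value_eq_sum[OF pol] exp_payment_eq_sum[OF pol] sum_subtractf[symmetric]
    by (intro sum.cong refl Bochner_Integration.integral_diff[symmetric] integrable_at_bid[OF pol]) auto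
  also have "\<dots> \<le> (\<Sum>t<T. \<integral>\<omega>. lp_surplus_at (\<omega> t) (bid \<pi> \<omega> t) \<partial>slots D {..<T})"
  proof (intro sum_mono integral_mono_AE)
    fix t assume "t \<in> {..<T}"
    then show "AE \<omega> in slots D {..<T}.
        value_at (\<omega> t) (bid \<pi> \<omega> t) - pay_at (\<omega> t) (bid \<pi> \<omega> t) \<le> lp_surplus_at (\<omega> t) (bid \<pi> \<omega> t)"
      using b by (intro eventually_mono[OF AE_slots_typical[of "{..<T}"]] surplus_at_le) (auto simp: bid_def)
  qed (auto intro!: integrable_at_bid[OF pol] Bochner_Integration.integrable_diff)
  also have "\<dots> = (\<Sum>t<T. surplus - (\<Sum>v\<in>vals D. extra_cost v * mean_high_prob T \<pi> t v))"
    by (intro sum.cong refl expectation_lp_surplus_bid[OF pol]) auto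
  finally show ?thesis
    by (simp add: sum_subtractf sum_mean_high_prob)
qed

text \<open>Shows that the supremum in \<open>OPT\<close> is over a nonempty set, without which a
  bound on every member would not bound the real supremum.\<close>

lemma truthful_benchmark: "benchmark_policy T (\<lambda>t h v u. v)" "rosc D T (\<lambda>t h v u. v)"
proof -
  have pol: "is_policy T (\<lambda>t h v u. v)"
    unfolding is_policy_def by (simp add: case_prod_beta')
  then show "benchmark_policy T (\<lambda>t h v u. v)"
    by (simp add: benchmark_policy_def)
  show "rosc D T (\<lambda>t h v u. v)"
    unfolding rosc_def exp_value_eq_sum[OF pol] exp_payment_eq_sum[OF pol]
    by (intro sum_mono integral_mono integrable_at_bid[OF pol])
       (auto simp: bid_def pay_at_def value_at_def pay_def alloc_def)
qed

text \<open>The index set \<open>I\<close> is kept general because the same estimate is used over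
  the learning slots alone (for the ROSC) and over all slots but one decision slot (for the
  value).\<close>

lemma emp_mean_deviation:
  assumes f [measurable]: "f \<in> borel_measurable borel" and range: "\<And>z. typical z \<Longrightarrow> 0 \<le> f z \<and> f z \<le> (1::real)"
    and I: "finite I" "{..<n} \<subseteq> I" and n: "n > 0" and \<epsilon>: "\<epsilon> > 0"
  shows "\<P>(\<omega> in slots D I. \<bar>(\<Sum>i<n. f (fst (\<omega> i))) / n - (\<integral>z. f z \<partial>D)\<bar> \<ge> \<epsilon>) \<le> 1 / (n * \<epsilon>\<^sup>2)"
proof -
  let ?S = "slots D I" and ?X = "\<lambda>i \<omega>::nat \<Rightarrow> slot. f (fst (\<omega> i))"
  interpret S: prob_space ?S by (rule prob_space_slots)
  have distr_coord: "distr ?S slot_dist (\<lambda>\<omega>. \<omega> i) = slot_dist" if "i < n" for i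
    unfolding slots_def by (rule distr_PiM_component) (use I that in \<open>auto, unfold_locales\<close>)
  have [measurable]: "(\<lambda>\<omega>. \<omega> i) \<in> ?S \<rightarrow>\<^sub>M borel" if "i < n" for i
    using I that by auto
  have ff: "(\<lambda>y. f (fst y)) \<in> borel_measurable slot_dist"
    by (rule measurable_compose[OF borel_measurable_fst[OF measurable_ident_sets[OF sets_slot_dist]] f])
  have "S.indep_vars (\<lambda>_. slot_dist) (\<lambda>i \<omega>. \<omega> i) {..<n}"
  proof (subst S.indep_vars_iff_distr_eq_PiM')
    have "(\<Pi>\<^sub>M i\<in>{..<n}. distr ?S slot_dist (\<lambda>\<omega>. \<omega> i)) = (\<Pi>\<^sub>M i\<in>{..<n}. slot_dist)"
      by (intro PiM_cong refl distr_coord) auto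
    moreover have "distr ?S (\<Pi>\<^sub>M i\<in>{..<n}. slot_dist) (\<lambda>\<omega>. \<lambda>i\<in>{..<n}. \<omega> i) =
        (\<Pi>\<^sub>M i\<in>{..<n}. slot_dist)"
      unfolding slots_def by (rule PS.distr_restrict[OF I(2,1), symmetric])
    ultimately show "distr ?S (\<Pi>\<^sub>M i\<in>{..<n}. slot_dist) (\<lambda>\<omega>. \<lambda>i\<in>{..<n}. \<omega> i) =
        (\<Pi>\<^sub>M i\<in>{..<n}. distr ?S slot_dist (\<lambda>\<omega>. \<omega> i))"
      by simp
  qed (use n in auto)
  then have indep: "S.indep_vars (\<lambda>_. borel) ?X {..<n}"
    by (rule S.indep_vars_compose2[where Y = "\<lambda>_ y. f (fst y)"])
       (rule ff)
  have distr_X: "distr ?S borel (?X i) = distr D borel f" if "i < n" for i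
  proof -
    have "distr ?S borel (?X i) = distr (distr ?S slot_dist (\<lambda>\<omega>. \<omega> i)) borel (\<lambda>y. f (fst y))"
      using that by (subst distr_distr[OF ff]) (auto simp: comp_def)
    also have "\<dots> = distr (distr slot_dist D fst) borel f"
      using that by (subst distr_distr) (auto simp: comp_def distr_coord)
    finally show ?thesis by (simp add: U.distr_pair_fst)
  qed
  have hoeffding: "Hoeffding_ineq_iid ?S {..<n} ?X (?X 0) 0 1"
  proof (unfold Hoeffding_ineq_iid_def, unfold_locales)
    show "S.indep_vars (\<lambda>_. borel) ?X {..<n}" by (rule indep)
    show "distr ?S borel (?X i) = distr ?S borel (?X 0)" if "i \<in> {..<n}" for i
      using that n by (simp only: distr_X lessThan_iff)
    show "?X 0 \<in> borel_measurable ?S" using n by measurable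
    have "0 \<in> I" using I n by auto
    then have "?X 0 \<omega> \<in> {0..1}" if "\<forall>t\<in>I. typical (fst (\<omega> t))" for \<omega>
      using that range[of "fst (\<omega> 0)"] by simp
    with AE_slots_typical[OF I(1)] show "AE \<omega> in ?S. ?X 0 \<omega> \<in> {0..1}" by (rule eventually_mono)
  qed simp
  have "S.expectation (?X 0) = (\<integral>x. x \<partial>distr ?S borel (?X 0))"
    using n by (subst integral_distr) auto
  also have "\<dots> = (\<integral>z. f z \<partial>D)"
    using n by (simp add: distr_X integral_distr)
  finally have mean: "S.expectation (?X 0) = (\<integral>z. f z \<partial>D)" .
  have "\<P>(\<omega> in ?S. \<bar>(\<Sum>i<n. ?X i \<omega>) / n - (\<integral>z. f z \<partial>D)\<bar> \<ge> \<epsilon>) \<le> 2 * exp (- 2 * n * \<epsilon>\<^sup>2)"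
    using Hoeffding_ineq_iid.Hoeffding_ineq_abs_ge'[OF hoeffding, of \<epsilon>] \<epsilon> n mean
    by (simp add: lessThan_empty_iff)
  \<comment> \<open>From e^x >= x. With \<epsilon> fixed, a decay of order 1/n already beats the
    target rate 1/sqrt T.\<close>
  also have "\<dots> \<le> 1 / (n * \<epsilon>\<^sup>2)"
  proof -
    have "2 * n * \<epsilon>\<^sup>2 \<le> exp (2 * n * \<epsilon>\<^sup>2)"
      using exp_ge_add_one_self[of "2 * n * \<epsilon>\<^sup>2"] by linarith
    then have "inverse (exp (2 * n * \<epsilon>\<^sup>2)) \<le> inverse (2 * n * \<epsilon>\<^sup>2)"
      using n \<epsilon> by (intro le_imp_inverse_le) auto
    then have "2 * exp (- 2 * n * \<epsilon>\<^sup>2) \<le> 2 * inverse (2 * n * \<epsilon>\<^sup>2)"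
      by (simp add: exp_minus)
    then show ?thesis using n \<epsilon> by (simp add: divide_simps)
  qed
  finally show ?thesis .
qed

end

section \<open>The estimated linear program\<close>

definition empirical :: "nat \<Rightarrow> (real \<times> real \<Rightarrow> real) \<Rightarrow> (nat \<Rightarrow> real \<times> real) \<Rightarrow> real" where
  "empirical n f z = (\<Sum>i<n. f (z i)) / n"

abbreviation emp_surplus :: "nat \<Rightarrow> (nat \<Rightarrow> real \<times> real) \<Rightarrow> real" where
  "emp_surplus n \<equiv> empirical n (\<lambda>y. max 0 (fst y - snd y))"

abbreviation emp_prob :: "nat \<Rightarrow> (nat \<Rightarrow> real \<times> real) \<Rightarrow> real \<Rightarrow> real" where
  "emp_prob n z v \<equiv> empirical n (\<lambda>y. of_bool (fst y = v \<and> snd y > v)) z"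

abbreviation emp_cost :: "nat \<Rightarrow> (nat \<Rightarrow> real \<times> real) \<Rightarrow> real \<Rightarrow> real" where
  "emp_cost n z v \<equiv> empirical n (\<lambda>y. of_bool (fst y = v \<and> snd y > v) * (snd y - v)) z"

lemma emp_cost_nonneg: "0 \<le> emp_cost n z v"
  unfolding empirical_def by (intro divide_nonneg_nonneg sum_nonneg) auto

lemma emp_prob_bounds: "0 \<le> emp_prob n z v" "emp_prob n z v \<le> 1"
proof -
  show "0 \<le> emp_prob n z v"
    unfolding empirical_def by (intro divide_nonneg_nonneg sum_nonneg) auto
  have "(\<Sum>i<n. of_bool (fst (z i) = v \<and> snd (z i) > v)) \<le> (\<Sum>i<n. 1 :: real)"
    by (intro sum_mono) auto
  then show "emp_prob n z v \<le> 1"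
    unfolding empirical_def by (cases "n = 0") (auto simp: divide_le_eq_1)
qed

text \<open>A positive frequency comes from at least one sample with \<theta> above
  \<open>v\<close>, and that sample contributes a strictly positive overpayment.\<close>

lemma emp_cost_pos:
  assumes "emp_prob n z v > 0"
  shows "emp_cost n z v > 0" "v \<in> (\<lambda>i. fst (z i)) ` {..<n}"
proof -
  obtain i where i: "i < n" "fst (z i) = v" "snd (z i) > v"
  proof (rule ccontr)
    assume "\<not> thesis"
    then have "(\<Sum>i<n. of_bool (fst (z i) = v \<and> snd (z i) > v)) = (0::real)"
      using that by (intro sum.neutral) auto
    then show False using assms by (simp add: empirical_def)
  qed
  then show "v \<in> (\<lambda>i. fst (z i)) ` {..<n}" by auto
  have "0 < (\<Sum>i<n. of_bool (fst (z i) = v \<and> snd (z i) > v) * (snd (z i) - v))"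
    using i by (intro sum_pos2[of _ i]) auto
  then show "emp_cost n z v > 0"
    using i by (auto simp: empirical_def)
qed

lemma emp_eq_0:
  assumes "v \<notin> (\<lambda>i. fst (z i)) ` {..<n}"
  shows "emp_prob n z v = 0" "emp_cost n z v = 0"
  using assms by (auto simp: empirical_def intro!: sum.neutral)

lemma sum_of_bool_mult:
  fixes f :: "'a \<Rightarrow> real"
  assumes "finite A"
  shows "(\<Sum>i\<in>A. of_bool (P i) * f i) = (\<Sum>i\<in>{i\<in>A. P i}. f i)"
  using assms unfolding sum.inter_filter[OF assms] by (intro sum.cong) auto

text \<open>The quotients telescope. If an inner set is empty, both sides are 0 under the
  conventions x/0 = 0 and empty mean 0.\<close>

lemma nested_means:
  fixes f :: "'a \<Rightarrow> real"
  assumes "finite A" "C \<subseteq> B" "B \<subseteq> A"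
  shows "real (card B) / card A * (real (card C) / card B) * ((\<Sum>i\<in>C. f i) / card C) =
    (\<Sum>i\<in>C. f i) / card A"
    and "real (card B) / card A * (real (card C) / card B) = card C / card A"
proof -
  have fin: "finite B" "finite C" using assms by (auto intro: finite_subset)
  show "real (card B) / card A * (real (card C) / card B) * ((\<Sum>i\<in>C. f i) / card C) =
      (\<Sum>i\<in>C. f i) / card A"
    using fin assms by (cases "C = {}"; cases "B = {}") (auto simp: card_eq_0_iff)
  show "real (card B) / card A * (real (card C) / card B) = card C / card A"
    using fin assms by (cases "B = {}") (auto simp: card_eq_0_iff)
qed

text \<open>The random sample sizes cancel, leaving averages over all \<open>n\<close> learning
  slots, to which Hoeffding's inequality applies directly.\<close>

lemma estimates_joint:
  fixes n z
  defines "P \<equiv> estimates n z"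
  shows "p P v * wr P v = emp_prob n z v"
    and "p P v * wr P v * r P v = emp_cost n z v"
    and "p P v * wl P v * l P v = empirical n (\<lambda>y. of_bool (fst y = v \<and> snd y \<le> v) * (v - snd y)) z"
proof -
  let ?N = "{i\<in>{..<n}. fst (z i) = v}"
  let ?R = "{i\<in>{..<n}. fst (z i) = v \<and> snd (z i) > v}"
  let ?L = "{i\<in>{..<n}. fst (z i) = v \<and> snd (z i) \<le> v}"
  have R: "{i\<in>?N. snd (z i) > v} = ?R" and L: "{i\<in>?N. snd (z i) \<le> v} = ?L" by auto
  have p: "p P v = real (card ?N) / card {..<n}"
    using sum_of_bool_mult[of "{..<n}" "\<lambda>i. fst (z i) = v" "\<lambda>_. 1"]
    by (simp add: P_def estimates_def sample_mean_def)
  have wr: "wr P v = real (card ?R) / card ?N"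
    using sum_of_bool_mult[of ?N "\<lambda>i. snd (z i) > v" "\<lambda>_. 1"]
    by (simp add: P_def estimates_def sample_mean_def R[simplified])
  have wl: "wl P v = real (card ?L) / card ?N"
    using sum_of_bool_mult[of ?N "\<lambda>i. snd (z i) \<le> v" "\<lambda>_. 1"]
    by (simp add: P_def estimates_def sample_mean_def L[simplified])
  have r: "r P v = (\<Sum>i\<in>?R. snd (z i) - v) / card ?R"
    and l: "l P v = (\<Sum>i\<in>?L. v - snd (z i)) / card ?L"
    by (simp_all add: P_def estimates_def sample_mean_def)
  show "p P v * wr P v = emp_prob n z v"
    using sum_of_bool_mult[of "{..<n}" "\<lambda>i. fst (z i) = v \<and> snd (z i) > v" "\<lambda>_. 1"]
    unfolding p wr by (subst nested_means) (auto simp: empirical_def)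
  show "p P v * wr P v * r P v = emp_cost n z v"
    using sum_of_bool_mult[of "{..<n}" "\<lambda>i. fst (z i) = v \<and> snd (z i) > v" "\<lambda>i. snd (z i) - v"]
    unfolding p wr r by (subst nested_means) (auto simp: empirical_def)
  show "p P v * wl P v * l P v = empirical n (\<lambda>y. of_bool (fst y = v \<and> snd y \<le> v) * (v - snd y)) z"
    using sum_of_bool_mult[of "{..<n}" "\<lambda>i. fst (z i) = v \<and> snd (z i) \<le> v" "\<lambda>i. v - snd (z i)"]
    unfolding p wl l by (subst nested_means) (auto simp: empirical_def)
qed

lemma V_estimates: "V (estimates n z) = (\<lambda>i. fst (z i)) ` {..<n}"
  by (simp add: estimates_def)

text \<open>After exchanging the sums, every sample contributes at exactly one value, namely its
  own.\<close>

lemma estimates_surplus: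
  "(\<Sum>v\<in>V (estimates n z). p (estimates n z) v * wl (estimates n z) v * l (estimates n z) v) =
    emp_surplus n z"
proof -
  have "(\<Sum>v\<in>V (estimates n z). p (estimates n z) v * wl (estimates n z) v * l (estimates n z) v) =
      (\<Sum>i<n. \<Sum>v\<in>V (estimates n z). of_bool (fst (z i) = v \<and> snd (z i) \<le> v) * (v - snd (z i))) / n"
    unfolding estimates_joint empirical_def sum_divide_distrib[symmetric]
    by (subst sum.swap) simp
  also have "(\<Sum>i<n. \<Sum>v\<in>V (estimates n z). of_bool (fst (z i) = v \<and> snd (z i) \<le> v) * (v - snd (z i))) =
      (\<Sum>i<n. max 0 (fst (z i) - snd (z i)))"
  proof (intro sum.cong refl)
    fix i assume i: "i \<in> {..<n}"
    have "(\<Sum>v\<in>V (estimates n z). of_bool (fst (z i) = v \<and> snd (z i) \<le> v) * (v - snd (z i))) =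
        (\<Sum>v\<in>V (estimates n z). if v = fst (z i) then max 0 (fst (z i) - snd (z i)) else 0)"
      by (intro sum.cong) (auto simp: max_def)
    then show "(\<Sum>v\<in>V (estimates n z). of_bool (fst (z i) = v \<and> snd (z i) \<le> v) * (v - snd (z i))) =
        max 0 (fst (z i) - snd (z i))"
      using i by (auto simp: V_estimates)
  qed
  finally show ?thesis by (simp add: empirical_def)
qed

lemma lp_feasible_estimates:
  "lp_feasible (estimates n z) q \<longleftrightarrow>
     (\<forall>v\<in>V (estimates n z). 0 \<le> q v \<and> q v \<le> 1) \<and>
     (\<Sum>v\<in>V (estimates n z). emp_cost n z v * q v) \<le> emp_surplus n z"
  unfolding lp_feasible_def estimates_surplus estimates_joint(2) ..

lemma lp_optimal_estimates:
  assumes "lp_optimal (estimates n z) q" "lp_feasible (estimates n z) q'"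
  shows "(\<Sum>v\<in>V (estimates n z). v * emp_prob n z v * q' v) \<le>
    (\<Sum>v\<in>V (estimates n z). v * emp_prob n z v * q v)"
proof -
  have "lp_objective (estimates n z) q' \<le> lp_objective (estimates n z) q"
    using assms by (auto simp: lp_optimal_def)
  then show ?thesis
    unfolding lp_objective_def estimates_joint by (simp add: mult_ac)
qed

lemma sample_mean_cong:
  assumes "I = J" "\<And>i. i \<in> J \<Longrightarrow> X i = Y i"
  shows "sample_mean I X = sample_mean J Y"
  using assms by (simp add: sample_mean_def)

lemma estimates_cong:
  assumes "\<And>i. i < n \<Longrightarrow> z i = z' i"
  shows "estimates n z = estimates n z'"
  unfolding estimates_def
  by (intro lp_params.equality; simp; (intro ext sample_mean_cong)?; use assms in \<open>auto simp: image_iff\<close>)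

context auction
begin

section \<open>Lower bounds on the program data within a class of instances\<close>

lemma integral_of_bool_D:
  assumes [measurable]: "{z. P z} \<in> sets borel"
  shows "(\<integral>z. of_bool (P z) \<partial>D) = measure D {z. P z}"
proof -
  have "(\<integral>z. of_bool (P z) \<partial>D) = (\<integral>z. indicator {z. P z} z \<partial>D)"
    by (intro Bochner_Integration.integral_cong) (auto simp: indicator_def)
  also have "\<dots> = measure D {z. P z}" by simp
  finally show ?thesis .
qed

lemma val_prob_mult_cond_prob:
  assumes "{z. fst z = v \<and> P z} \<in> sets borel"
  shows "val_prob D v * \<P>(z in D. P z \<bar> fst z = v) = measure D {z. fst z = v \<and> P z}"
proof -
  have "measure D {z. fst z = v \<and> P z} \<le> val_prob D v"
    unfolding val_prob_def by (intro D.finite_measure_mono) auto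
  moreover have "{z. P z \<and> fst z = v} = {z. fst z = v \<and> P z}" by auto
  ultimately show ?thesis
    unfolding cond_prob_def using measure_nonneg[of D "{z. fst z = v \<and> P z}"]
    by (auto simp: val_prob_def intro: antisym)
qed

lemma extra_prob_eq: "extra_prob v = val_prob D v * w_right D v"
proof -
  have "{z::real \<times> real. fst z = v \<and> snd z > v} \<in> sets borel" by measurable
  moreover have "{z::real \<times> real. fst z = v \<and> snd z > fst z} = {z. fst z = v \<and> snd z > v}" by auto
  ultimately show ?thesis
    unfolding extra_prob_def w_right_def
    by (subst val_prob_mult_cond_prob) (auto simp: integral_of_bool_D)
qed

text \<open>Undoes the conditioning in \<open>gain\<close>. If the conditioning event is null, the
  weight on the left is 0 and the integrand on the right is almost surely 0.\<close>

lemma gain_eq: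
  "val_prob D v * w_left D v * gain D v = (\<integral>z. of_bool (fst z = v \<and> snd z \<le> v) * (v - snd z) \<partial>D)"
proof -
  define A where "A = {z::real \<times> real. fst z = v \<and> snd z \<le> v}"
  have A [measurable]: "A \<in> sets borel" unfolding A_def by measurable
  have eq: "{z::real \<times> real. fst z = v \<and> snd z \<le> fst z} = A" by (auto simp: A_def)
  have m: "val_prob D v * w_left D v = measure D A"
    unfolding w_left_def by (subst val_prob_mult_cond_prob) (simp_all add: eq A)
  have ind: "of_bool (fst z = v \<and> snd z \<le> v) = (indicator A z :: real)" for z
    by (auto simp: A_def indicator_def)
  show ?thesis
  proof (cases "measure D A = 0")
    case True
    then have "AE z in D. z \<notin> A"
      by (intro AE_not_in) (simp add: null_sets_def D.emeasure_eq_measure A)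
    then have "(\<integral>z. indicator A z * (v - snd z) \<partial>D) = 0"
      by (intro integral_eq_zero_AE) auto
    then show ?thesis by (simp add: m True ind)
  next
    case False
    then have pos: "measure D A > 0" using measure_nonneg[of D A] by linarith
    have "uniform_measure D A = density D (\<lambda>z. ennreal (indicator A z / measure D A))"
      unfolding uniform_measure_def using pos
      by (intro density_cong) (auto simp: D.emeasure_eq_measure divide_ennreal[symmetric] split: split_indicator)
    then have "gain D v = (\<integral>z. (indicator A z / measure D A) *\<^sub>R (v - snd z) \<partial>D)"
      unfolding gain_def A_def[symmetric] by (simp add: integral_density pos)
    also have "\<dots> = (\<integral>z. indicator A z * (v - snd z) / measure D A \<partial>D)"
      by (intro Bochner_Integration.integral_cong) auto
    also have "\<dots> = (\<integral>z. indicator A z * (v - snd z) \<partial>D) / measure D A" by simp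
    finally show ?thesis using pos by (simp add: m ind)
  qed
qed

lemma surplus_eq_sum: "surplus = (\<Sum>v\<in>vals D. val_prob D v * w_left D v * gain D v)"
proof -
  let ?f = "\<lambda>v z. of_bool (fst z = v \<and> snd z \<le> v) * (v - snd z) :: real"
  have "surplus = (\<integral>z. (\<Sum>v\<in>vals D. ?f v z) \<partial>D)"
    unfolding surplus_def
  proof (rule integral_cong_AE)
    show "AE z in D. max 0 (fst z - snd z) = (\<Sum>v\<in>vals D. ?f v z)"
      using AE_typical
    proof eventually_elim
      case (elim z)
      have "(\<Sum>v\<in>vals D. ?f v z) = (\<Sum>v\<in>vals D. if v = fst z then max 0 (fst z - snd z) else 0)"
        by (intro sum.cong) (auto simp: max_def)
      then show ?case using elim finite_vals by (simp add: typical_def)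
    qed
  qed auto
  also have "\<dots> = (\<Sum>v\<in>vals D. \<integral>z. ?f v z \<partial>D)"
  proof (intro Bochner_Integration.integral_sum)
    fix v show "integrable D (?f v)"
      by (rule integrable_bounded_D[where B = "1 + \<bar>v\<bar>"]) (auto simp: typical_def)
  qed
  finally show ?thesis by (simp add: gain_eq)
qed

lemma gain_term_nonneg: "0 \<le> val_prob D v * w_left D v * gain D v"
  unfolding gain_eq by (intro integral_nonneg_AE AE_I2) auto

text \<open>A nonzero surplus has a nonzero summand, a product of three factors that are each
  positive and hence at least \<eta>; likewise \<open>extra_prob v\<close> is a product of two.
  Positivity of \<open>gain\<close> follows from that of the whole product.\<close>

lemma instance_bounds:
  assumes "D \<in> instances K \<eta>" "\<eta> > 0"
  shows "\<eta> \<le> 1" "surplus \<noteq> 0 \<Longrightarrow> \<eta> ^ 3 \<le> surplus"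
    and "v \<in> vals D \<Longrightarrow> extra_prob v \<noteq> 0 \<Longrightarrow> \<eta> ^ 2 \<le> extra_prob v"
proof -
  have bound: "x \<ge> \<eta>"
    if "v \<in> vals D" "x \<in> {v, val_prob D v, w_left D v, w_right D v, gain D v}" "x > 0" for v x
    using assms(1) that unfolding instances_def by blast
  have nn: "0 \<le> val_prob D v" "0 \<le> w_left D v" "0 \<le> w_right D v" for v
    by (simp_all add: val_prob_def w_left_def w_right_def cond_prob_def)
  obtain v' where "v' \<in> vals D" using K_pos card_vals by fastforce
  then have "\<eta> \<le> val_prob D v'" by (intro bound[of v']) (auto simp: vals_def)
  also have "\<dots> \<le> 1" unfolding val_prob_def by (rule D.prob_le_1)
  finally show "\<eta> \<le> 1" .
  show "\<eta> ^ 3 \<le> surplus" if "surplus \<noteq> 0"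
  proof -
    have "(\<Sum>v\<in>vals D. val_prob D v * w_left D v * gain D v) \<noteq> 0"
      using that by (simp add: surplus_eq_sum)
    then obtain v where v: "v \<in> vals D" "val_prob D v * w_left D v * gain D v \<noteq> 0"
      by (rule sum.not_neutral_contains_not_neutral)
    then have pos: "val_prob D v > 0" "w_left D v > 0"
      using nn[of v] by (auto simp: less_le)
    moreover have "gain D v > 0"
    proof (rule zero_less_mult_pos)
      show "0 < (val_prob D v * w_left D v) * gain D v"
        using gain_term_nonneg[of v] v(2) by linarith
    qed (use pos in simp)
    ultimately have "\<eta> * \<eta> * \<eta> \<le> val_prob D v * w_left D v * gain D v"
      using bound[OF v(1)] assms(2) by (intro mult_mono) auto
    also have "\<dots> \<le> surplus"
      unfolding surplus_eq_sum using v(1) finite_vals gain_term_nonneg by (intro member_le_sum) auto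
    finally show ?thesis by (simp add: power3_eq_cube)
  qed
  show "\<eta> ^ 2 \<le> extra_prob v" if "v \<in> vals D" "extra_prob v \<noteq> 0"
  proof -
    have "val_prob D v > 0" "w_right D v > 0"
      using that(2) nn[of v] unfolding extra_prob_eq by (auto simp: less_le)
    then have "\<eta> * \<eta> \<le> val_prob D v * w_right D v"
      using bound[OF that(1)] assms(2) by (intro mult_mono) auto
    then show ?thesis by (simp add: extra_prob_eq power2_eq_square)
  qed
qed

text \<open>Accuracy is asked of the data of the linear program rather than of the individual
  parameters. The strict inequalities are used to conclude that a frequency is positive when its
  mean is at least \<epsilon>.\<close>

definition accurate :: "nat \<Rightarrow> real \<Rightarrow> (nat \<Rightarrow> real \<times> real) \<Rightarrow> bool" where
  "accurate n \<epsilon> z \<longleftrightarrow> \<bar>emp_surplus n z - surplus\<bar> < \<epsilon> \<and>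
     (\<forall>v\<in>vals D. \<bar>emp_prob n z v - extra_prob v\<bar> < \<epsilon> \<and> \<bar>emp_cost n z v - extra_cost v\<bar> < \<epsilon>)"

text \<open>The extension by 0 reflects that values unseen during learning are bid truthfully; it
  turns sums over the observed values into sums over \<open>vals D\<close>.\<close>

definition played :: "nat \<Rightarrow> (nat \<Rightarrow> real \<times> real) \<Rightarrow> (real \<Rightarrow> real) \<Rightarrow> real \<Rightarrow> real" where
  "played n z q v = (if v \<in> V (estimates n z) then q v else 0)"

lemma played_bounds:
  assumes "lp_feasible (estimates n z) q"
  shows "0 \<le> played n z q v" "played n z q v \<le> 1"
  using assms by (auto simp: played_def lp_feasible_estimates)

lemma sum_played:
  assumes "\<And>i. i < n \<Longrightarrow> fst (z i) \<in> vals D"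
  shows "(\<Sum>v\<in>V (estimates n z). c v * q v) = (\<Sum>v\<in>vals D. c v * played n z q v)"
proof (rule sum.mono_neutral_cong_left)
  show "V (estimates n z) \<subseteq> vals D" using assms by (auto simp: V_estimates)
qed (auto simp: finite_vals played_def)

lemma sum_deviation:
  fixes c d x :: "real \<Rightarrow> real" and \<epsilon> :: real
  assumes "\<And>v. v \<in> vals D \<Longrightarrow> \<bar>c v - d v\<bar> \<le> \<epsilon>" "\<And>v. v \<in> vals D \<Longrightarrow> 0 \<le> x v \<and> x v \<le> 1"
  shows "(\<Sum>v\<in>vals D. c v * x v) \<le> (\<Sum>v\<in>vals D. d v * x v) + K * \<epsilon>"
proof -
  have "(\<Sum>v\<in>vals D. c v * x v) \<le> (\<Sum>v\<in>vals D. d v * x v + \<epsilon>)"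
  proof (intro sum_mono)
    fix v assume v: "v \<in> vals D"
    have "(c v - d v) * x v \<le> \<bar>c v - d v\<bar> * 1"
      using assms(2)[OF v] by (intro mult_mono) auto
    then show "c v * x v \<le> d v * x v + \<epsilon>" using assms(1)[OF v] by (simp add: algebra_simps)
  qed
  then show ?thesis by (simp add: sum.distrib card_vals)
qed

text \<open>Here \<open>m\<close> is the length of the decision phase, whose expected surplus per
  slot may be negative but is at least -(K + 1)\<epsilon>: K\<epsilon> from the costs and \<epsilon>
  from the budget. As \<open>m\<close> is at most 2n, an empirical surplus of 2(K + 1)\<epsilon> in
  the learning phase pays for it; the third \<epsilon> in 2K + 3 is the error of that empirical
  surplus.\<close>

lemma played_surplus_nonneg:
  fixes n m :: nat and \<epsilon> :: real
  assumes acc: "accurate n \<epsilon> z" and vals: "\<And>i. i < n \<Longrightarrow> fst (z i) \<in> vals D"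
    and feas: "lp_feasible (estimates n z) q"
    and zero: "surplus = 0 \<Longrightarrow> emp_surplus n z = 0"
    and large: "surplus \<noteq> 0 \<Longrightarrow> (2 * K + 3) * \<epsilon> \<le> surplus"
    and extra: "\<And>v. v \<in> vals D \<Longrightarrow> extra_prob v \<noteq> 0 \<Longrightarrow> \<epsilon> \<le> extra_prob v"
    and m: "m \<le> 2 * n"
  shows "0 \<le> n * emp_surplus n z + m * (surplus - (\<Sum>v\<in>vals D. extra_cost v * played n z q v))"
proof (cases "surplus = 0")
  case True
  have V: "finite (V (estimates n z))" by (simp add: V_estimates)
  have "(\<Sum>v\<in>V (estimates n z). emp_cost n z v * q v) = 0"
    using feas zero[OF True] emp_cost_nonneg
    by (intro antisym sum_nonneg) (auto simp: lp_feasible_estimates)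
  then have no_cost: "emp_cost n z v * q v = 0" if "v \<in> V (estimates n z)" for v
    using feas emp_cost_nonneg that V
    by (subst (asm) sum_nonneg_eq_0_iff) (auto simp: lp_feasible_estimates)
  have "extra_cost v * played n z q v = 0" if v: "v \<in> vals D" for v
  proof (cases "extra_prob v = 0")
    case False
    \<comment> \<open>Accuracy forces a learning sample with this value and a larger \<theta>. Its
      estimated cost is positive while the estimated budget is 0, so \<open>no_cost\<close> gives
      \<open>q v = 0\<close>.\<close>
    then have "emp_prob n z v > 0"
      using acc v extra[OF v] unfolding accurate_def by fastforce
    then have "played n z q v = 0"
      using emp_cost_pos[where n = n and z = z and v = v] no_cost[of v] by (auto simp: played_def)
    then show ?thesis by simp
  qed (simp add: extra_cost_eq_0_iff)
  then have "(\<Sum>v\<in>vals D. extra_cost v * played n z q v) = 0" by (intro sum.neutral) blast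
  then show ?thesis by (simp add: True zero)
next
  case False
  have es: "\<bar>emp_surplus n z - surplus\<bar> < \<epsilon>" using acc by (simp add: accurate_def)
  then have \<epsilon>: "\<epsilon> \<ge> 0" by linarith
  have "(\<Sum>v\<in>vals D. extra_cost v * played n z q v) \<le>
      (\<Sum>v\<in>vals D. emp_cost n z v * played n z q v) + K * \<epsilon>"
    using acc played_bounds[OF feas] by (intro sum_deviation) (auto simp: accurate_def less_imp_le abs_minus_commute)
  also have "(\<Sum>v\<in>vals D. emp_cost n z v * played n z q v) \<le> emp_surplus n z"
    using feas by (simp add: sum_played[OF vals, symmetric] lp_feasible_estimates)
  finally have "- ((real K + 1) * \<epsilon>) \<le> surplus - (\<Sum>v\<in>vals D. extra_cost v * played n z q v)"
    using es by (simp add: algebra_simps)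
  then have "m * - ((real K + 1) * \<epsilon>) \<le> m * (surplus - (\<Sum>v\<in>vals D. extra_cost v * played n z q v))"
    by (intro mult_left_mono) auto
  moreover have "m * ((real K + 1) * \<epsilon>) \<le> (2 * real n) * ((real K + 1) * \<epsilon>)"
    using m \<epsilon> by (intro mult_right_mono) auto
  moreover have "n * (2 * (real K + 1) * \<epsilon>) \<le> n * emp_surplus n z"
    using es large[OF False] by (intro mult_left_mono) (auto simp: algebra_simps)
  ultimately show ?thesis by (simp add: algebra_simps)
qed

text \<open>
  Scaling a feasible point \<open>x\<close> of the true program by a factor close to \<open>1\<close> makes it feasible for
  the estimated one, whose optimum \<open>q\<close> therefore cannot be much worse.
\<close>

lemma played_near_optimal:
  fixes \<epsilon> a :: real
  assumes acc: "accurate n \<epsilon> z" and vals: "\<And>i. i < n \<Longrightarrow> fst (z i) \<in> vals D"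
    and opt: "lp_optimal (estimates n z) q"
    and a: "0 < a" "a \<le> surplus" "(K + 1) * \<epsilon> \<le> a"
    and x: "\<And>v. 0 \<le> x v \<and> x v \<le> 1" "(\<Sum>v\<in>vals D. extra_cost v * x v) \<le> surplus"
  shows "(\<Sum>v\<in>vals D. v * extra_prob v * x v) - (K * (K + 1) * \<epsilon> / a + 2 * K * \<epsilon>) \<le>
    (\<Sum>v\<in>vals D. v * extra_prob v * played n z q v)"
proof -
  have feas: "lp_feasible (estimates n z) q" using opt by (simp add: lp_optimal_def)
  have es: "\<bar>emp_surplus n z - surplus\<bar> < \<epsilon>" using acc by (simp add: accurate_def)
  then have \<epsilon>: "\<epsilon> \<ge> 0" by linarith
  \<comment> \<open>The estimated cost of \<open>x\<close> is at most
    \<open>surplus + K * \<epsilon>\<close>, which is at least \<open>a\<close>; so this factor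
    lowers the bound by at least (K + 1)\<epsilon>, to \<open>surplus - \<epsilon>\<close>, which is
    below the estimated budget.\<close>
  define \<kappa> where "\<kappa> = 1 - (K + 1) * \<epsilon> / a"
  have \<kappa>: "0 \<le> \<kappa>" "\<kappa> \<le> 1" using a \<epsilon> by (auto simp: \<kappa>_def)
  have off: "(\<Sum>v\<in>V (estimates n z). c v * x v) = (\<Sum>v\<in>vals D. c v * x v)"
    if "\<And>v. v \<notin> V (estimates n z) \<Longrightarrow> c v = 0" for c
    using that vals by (intro sum.mono_neutral_left) (auto simp: finite_vals V_estimates)
  have dev: "\<bar>v * emp_prob n z v - v * extra_prob v\<bar> \<le> \<epsilon>" if "v \<in> vals D" for v
  proof -
    have "\<bar>v * emp_prob n z v - v * extra_prob v\<bar> = v * \<bar>emp_prob n z v - extra_prob v\<bar>"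
      using vals_range[OF that] by (simp add: right_diff_distrib[symmetric] abs_mult)
    also have "\<dots> \<le> 1 * \<epsilon>"
      using vals_range[OF that] acc that by (intro mult_mono) (auto simp: accurate_def less_imp_le)
    finally show ?thesis by simp
  qed
  have "lp_feasible (estimates n z) (\<lambda>v. \<kappa> * x v)"
    unfolding lp_feasible_estimates
  proof
    show "\<forall>v\<in>V (estimates n z). 0 \<le> \<kappa> * x v \<and> \<kappa> * x v \<le> 1"
      using \<kappa> x(1) by (simp add: mult_le_one)
    have "(\<Sum>v\<in>V (estimates n z). emp_cost n z v * x v) = (\<Sum>v\<in>vals D. emp_cost n z v * x v)"
      by (intro off emp_eq_0) (auto simp: V_estimates)
    also have "\<dots> \<le> (\<Sum>v\<in>vals D. extra_cost v * x v) + K * \<epsilon>"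
      by (rule sum_deviation) (use acc x(1) in \<open>auto simp: accurate_def less_imp_le\<close>)
    also have "\<dots> \<le> surplus + K * \<epsilon>" using x(2) by simp
    finally have "\<kappa> * (\<Sum>v\<in>V (estimates n z). emp_cost n z v * x v) \<le> \<kappa> * (surplus + K * \<epsilon>)"
      using \<kappa> by (intro mult_left_mono)
    also have "\<dots> = surplus + K * \<epsilon> - (K + 1) * \<epsilon> * ((surplus + K * \<epsilon>) / a)"
      using a by (simp add: \<kappa>_def field_simps)
    also have "\<dots> \<le> surplus + K * \<epsilon> - (K + 1) * \<epsilon> * 1"
      using a \<epsilon> by (intro diff_left_mono mult_left_mono) (auto simp: le_divide_eq_1 add_increasing2)
    also have "\<dots> \<le> emp_surplus n z"
      using es by (simp add: algebra_simps)
    finally show "(\<Sum>v\<in>V (estimates n z). emp_cost n z v * (\<kappa> * x v)) \<le> emp_surplus n z"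
      by (simp add: sum_distrib_left mult_ac)
  qed
  from lp_optimal_estimates[OF opt this]
  have "\<kappa> * (\<Sum>v\<in>V (estimates n z). v * emp_prob n z v * x v) \<le>
      (\<Sum>v\<in>V (estimates n z). v * emp_prob n z v * q v)"
    by (simp add: sum_distrib_left mult_ac)
  moreover have "(\<Sum>v\<in>V (estimates n z). v * emp_prob n z v * q v) =
      (\<Sum>v\<in>vals D. v * emp_prob n z v * played n z q v)"
    by (rule sum_played[OF vals])
  moreover have "(\<Sum>v\<in>V (estimates n z). v * emp_prob n z v * x v) =
      (\<Sum>v\<in>vals D. v * emp_prob n z v * x v)"
    by (intro off) (simp add: emp_eq_0 V_estimates)
  \<comment> \<open>Shrinking by \<kappa> costs at most 1 - \<kappa> times this trivial bound K. The
    exchange of true and estimated probabilities costs K\<epsilon> twice, once for \<open>x\<close>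
    and once for \<open>q\<close>.\<close>
  moreover have "(\<Sum>v\<in>vals D. v * emp_prob n z v * x v) \<le> (\<Sum>v\<in>vals D. 1)"
    using emp_prob_bounds x(1) vals_range by (intro sum_mono mult_le_one mult_nonneg_nonneg) auto
  then have "(1 - \<kappa>) * (\<Sum>v\<in>vals D. v * emp_prob n z v * x v) \<le> (1 - \<kappa>) * K"
    using \<kappa> by (intro mult_left_mono) (auto simp: card_vals)
  moreover have "(1 - \<kappa>) * K = K * (K + 1) * \<epsilon> / a" by (simp add: \<kappa>_def algebra_simps)
  moreover have "(\<Sum>v\<in>vals D. v * extra_prob v * x v) \<le> (\<Sum>v\<in>vals D. v * emp_prob n z v * x v) + K * \<epsilon>"
    using dev x(1) by (intro sum_deviation) (auto simp: abs_minus_commute)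
  moreover have "(\<Sum>v\<in>vals D. v * emp_prob n z v * played n z q v) \<le>
      (\<Sum>v\<in>vals D. v * extra_prob v * played n z q v) + K * \<epsilon>"
    using dev played_bounds[OF feas] by (intro sum_deviation) auto
  ultimately show ?thesis by (simp add: algebra_simps)
qed

end

section \<open>Learn-Alg\<close>

text \<open>Decisions depend on the learning history only, so one strategy, fixed after learning,
  serves all decision slots.\<close>

lemma learn_alg_cong:
  assumes "T div 2 \<le> t" "T div 2 \<le> t'" "\<And>i. i < T div 2 \<Longrightarrow> h i = h' i"
  shows "learn_alg solve T t h v u = learn_alg solve T t' h' v u"
proof -
  have "estimates (T div 2) (\<lambda>i. fst (h i)) = estimates (T div 2) (\<lambda>i. fst (h' i))"
    using assms(3) by (intro estimates_cong) simp
  then show ?thesis using assms(1,2) by (simp add: learn_alg_def)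
qed

lemma learn_alg_bid: "learn_alg solve T t h v u = v \<or> learn_alg solve T t h v u = 1"
  by (simp add: learn_alg_def Let_def split: prod.split)

lemma learn_alg_learning: "t < T div 2 \<Longrightarrow> learn_alg solve T t h v u = v"
  by (simp add: learn_alg_def)

lemma lp_solverD:
  assumes "lp_solver n solve"
  shows "lp_optimal (estimates n z) (snd (solve (estimates n z)))"
    "lp_threshold (estimates n z) (fst (solve (estimates n z))) (snd (solve (estimates n z)))"
  using assms unfolding lp_solver_def by (auto simp: case_prod_beta)

context auction
begin

lemma uniform_below:
  assumes "0 \<le> q" "q \<le> 1"
  shows "(\<integral>u. of_bool (u < q) \<partial>U) = q"
proof -
  have "(\<integral>u. of_bool (u < q) \<partial>U) = (\<integral>u. indicator {..<q} u \<partial>U)"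
    by (intro Bochner_Integration.integral_cong) (auto simp: indicator_def)
  also have "\<dots> = measure U {..<q}" by simp
  also have "\<dots> = measure lborel ({0..1} \<inter> {..<q})"
    by (subst measure_uniform_measure) auto
  also have "{0..1} \<inter> {..<q} = {0..<q}" using assms by auto
  finally show ?thesis using assms by simp
qed

text \<open>The threshold property says that \<open>q\<close> is 1 above and 0 below \<sigma>, so
  bidding deterministically off the threshold still realises \<open>q\<close>. Below value 1 a
  truthful bid is not high.\<close>

lemma high_prob_learn_alg:
  fixes h :: "nat \<Rightarrow> slot"
  assumes solver: "lp_solver n solve" and n: "n = T div 2" "n \<le> t" and v: "v < 1"
  shows "high_prob (learn_alg solve T t h) v =
    played n (\<lambda>i. fst (h i)) (snd (solve (estimates n (\<lambda>i. fst (h i))))) v"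
proof -
  define P where "P = estimates n (\<lambda>i. fst (h i))"
  obtain \<sigma> q where \<sigma>q: "solve P = (\<sigma>, q)" by fastforce
  have thr: "lp_threshold P \<sigma> q" and opt: "lp_optimal P q"
    using lp_solverD[OF solver, of "\<lambda>i. fst (h i)"] \<sigma>q by (simp_all add: P_def)
  have q: "0 \<le> q v" "q v \<le> 1" if "v \<in> V P"
    using opt that by (auto simp: lp_optimal_def lp_feasible_def)
  have bid: "learn_alg solve T t h v u =
      (if v \<notin> V P then v else if v > \<sigma> * r P v then 1
       else if v = \<sigma> * r P v then (if u < q v then 1 else v) else v)" for u
    using n unfolding learn_alg_def n(1)[symmetric] P_def[symmetric] Let_def \<sigma>q by simp
  consider "v \<notin> V P" | "v \<in> V P" "v > \<sigma> * r P v" | "v \<in> V P" "v = \<sigma> * r P v"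
    | "v \<in> V P" "v < \<sigma> * r P v" by fastforce
  then have "high_prob (learn_alg solve T t h) v = (if v \<in> V P then q v else 0)"
  proof cases
    case 2
    moreover have "q v = 1" using 2 thr by (auto simp: lp_threshold_def)
    ultimately show ?thesis using U.prob_space by (simp add: high_prob_def bid)
  next
    case 3
    then have "high_prob (learn_alg solve T t h) v = (\<integral>u. of_bool (u < q v) \<partial>U)"
      using v unfolding high_prob_def bid
      by (intro Bochner_Integration.integral_cong) (auto simp del: mult_eq_0_iff)
    then show ?thesis using 3(1) uniform_below q by simp
  next
    case 4
    moreover have "q v = 0" using 4 thr by (auto simp: lp_threshold_def)
    ultimately show ?thesis using v by (simp add: high_prob_def bid)
  qed (use v in \<open>simp add: high_prob_def bid\<close>)
  then show ?thesis by (simp add: played_def P_def[symmetric] \<sigma>q)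
qed

section \<open>Probability of accurate estimates\<close>

lemma measurable_empirical:
  assumes "f \<in> borel_measurable borel" "{..<n} \<subseteq> I"
  shows "(\<lambda>\<omega>. empirical n f (\<lambda>i. fst (\<omega> i))) \<in> borel_measurable (slots D I)"
  unfolding empirical_def using assms(2)
  by (intro borel_measurable_divide borel_measurable_sum borel_measurable_const
      measurable_compose[OF borel_measurable_fst[OF measurable_slots_component] assms(1)]) auto

context
  fixes I :: "nat set" and n :: nat and \<epsilon> :: real
  assumes I: "finite I" "{..<n} \<subseteq> I" and n: "n > 0" and \<epsilon>: "\<epsilon> > 0"
begin

lemma accurate_measurable:
  "{\<omega> \<in> space (slots D I). accurate n \<epsilon> (\<lambda>i. fst (\<omega> i))} \<in> sets (slots D I)"
proof -
  have [measurable]: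
    "(\<lambda>\<omega>. emp_surplus n (\<lambda>i. fst (\<omega> i))) \<in> borel_measurable (slots D I)"
    "(\<lambda>\<omega>. emp_prob n (\<lambda>i. fst (\<omega> i)) v) \<in> borel_measurable (slots D I)"
    "(\<lambda>\<omega>. emp_cost n (\<lambda>i. fst (\<omega> i)) v) \<in> borel_measurable (slots D I)" for v
    by (intro measurable_empirical I(2); measurable)+
  show ?thesis
    unfolding accurate_def using finite_vals by measurable
qed

text \<open>Union bound over 2K + 1 averages: one for the surplus, and a probability and a cost for
  each value.\<close>

lemma prob_accurate:
  "\<P>(\<omega> in slots D I. accurate n \<epsilon> (\<lambda>i. fst (\<omega> i))) \<ge> 1 - (2 * K + 1) / (n * \<epsilon>\<^sup>2)"
proof -
  let ?S = "slots D I" and ?z = "\<lambda>\<omega> i. fst (\<omega> i) :: real \<times> real"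
  interpret S: prob_space ?S by (rule prob_space_slots)
  define bad where "bad f = {\<omega> \<in> space ?S. \<epsilon> \<le> \<bar>empirical n f (?z \<omega>) - (\<integral>z. f z \<partial>D)\<bar>}" for f
  have bad: "bad f \<in> sets ?S" "measure ?S (bad f) \<le> 1 / (n * \<epsilon>\<^sup>2)"
    if "f \<in> borel_measurable borel" "\<And>z. typical z \<Longrightarrow> 0 \<le> f z \<and> f z \<le> 1" for f
  proof -
    note [measurable] = measurable_empirical[OF that(1) I(2)]
    show "bad f \<in> sets ?S" unfolding bad_def by measurable
    show "measure ?S (bad f) \<le> 1 / (n * \<epsilon>\<^sup>2)"
      using emp_mean_deviation[OF that I n \<epsilon>] by (simp add: bad_def empirical_def)
  qed
  define Bs where "Bs = bad (\<lambda>y. max 0 (fst y - snd y))"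
  define Bp where "Bp v = bad (\<lambda>y. of_bool (fst y = v \<and> snd y > v))" for v
  define Bc where "Bc v = bad (\<lambda>y. of_bool (fst y = v \<and> snd y > v) * (snd y - v))" for v
  have Bs: "Bs \<in> sets ?S" "measure ?S Bs \<le> 1 / (n * \<epsilon>\<^sup>2)"
    unfolding Bs_def by (rule bad; auto dest!: typicalD)+
  have Bp: "Bp v \<in> sets ?S" "measure ?S (Bp v) \<le> 1 / (n * \<epsilon>\<^sup>2)" for v
    unfolding Bp_def by (rule bad; auto dest!: typicalD)+
  have Bc: "Bc v \<in> sets ?S" "measure ?S (Bc v) \<le> 1 / (n * \<epsilon>\<^sup>2)" for v
    unfolding Bc_def by (rule bad; auto dest!: typicalD)+
  have Bpc: "measure ?S (Bp v \<union> Bc v) \<le> 2 / (n * \<epsilon>\<^sup>2)" for v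
  proof -
    have "measure ?S (Bp v \<union> Bc v) \<le> 1 / (n * \<epsilon>\<^sup>2) + 1 / (n * \<epsilon>\<^sup>2)"
      using measure_Un_le[OF Bp(1) Bc(1), of v v] Bp(2)[of v] Bc(2)[of v] by linarith
    then show ?thesis by (simp add: add_divide_distrib[symmetric])
  qed
  have "\<P>(\<omega> in ?S. \<not> accurate n \<epsilon> (?z \<omega>)) \<le> measure ?S (Bs \<union> (\<Union>v\<in>vals D. Bp v \<union> Bc v))"
  proof (rule S.finite_measure_mono)
    show "{\<omega> \<in> space ?S. \<not> accurate n \<epsilon> (?z \<omega>)} \<subseteq> Bs \<union> (\<Union>v\<in>vals D. Bp v \<union> Bc v)"
      unfolding accurate_def Bs_def Bp_def Bc_def bad_def surplus_def extra_prob_def extra_cost_def not_less[symmetric]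
      by blast
    show "Bs \<union> (\<Union>v\<in>vals D. Bp v \<union> Bc v) \<in> sets ?S"
      using Bs(1) Bp(1) Bc(1) finite_vals by (intro sets.Un sets.finite_UN)
  qed
  also have "\<dots> \<le> measure ?S Bs + measure ?S (\<Union>v\<in>vals D. Bp v \<union> Bc v)"
    using Bs(1) Bp(1) Bc(1) finite_vals by (intro measure_Un_le sets.finite_UN sets.Un)
  also have "measure ?S (\<Union>v\<in>vals D. Bp v \<union> Bc v) \<le> (\<Sum>v\<in>vals D. measure ?S (Bp v \<union> Bc v))"
    using Bp(1) Bc(1) finite_vals by (intro S.finite_measure_subadditive_finite) auto
  also have "\<dots> \<le> (\<Sum>v\<in>vals D. 2 / (n * \<epsilon>\<^sup>2))" by (intro sum_mono Bpc)
  also have "\<dots> = 2 * K / (n * \<epsilon>\<^sup>2)" by (simp add: card_vals)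
  finally have "\<P>(\<omega> in ?S. \<not> accurate n \<epsilon> (?z \<omega>)) \<le> (2 * K + 1) / (n * \<epsilon>\<^sup>2)"
    using Bs(2) by (simp add: add_divide_distrib)
  then show ?thesis
    using S.prob_neg[OF accurate_measurable] by simp
qed

end

section \<open>Value and conditional ROSC of the algorithm in terms of the estimates\<close>

context
  fixes T :: nat and solve and n :: nat
  assumes solver: "lp_solver n solve" and pol: "is_policy T (learn_alg solve T)"
    and n_def: "n = T div 2"
begin

private abbreviation "\<pi> \<equiv> learn_alg solve T"

private abbreviation played_by :: "(nat \<Rightarrow> slot) \<Rightarrow> real \<Rightarrow> real" where
  "played_by \<omega> \<equiv> played n (\<lambda>i. fst (\<omega> i)) (snd (solve (estimates n (\<lambda>i. fst (\<omega> i)))))"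

lemma history_high_prob_learn_alg:
  assumes "n \<le> t" "v < 1"
  shows "history_high_prob \<pi> t \<omega> v = played_by \<omega> v"
proof -
  have "estimates n (\<lambda>i. fst (restrict \<omega> {..<t} i)) = estimates n (\<lambda>i. fst (\<omega> i))"
    using assms by (intro estimates_cong) simp
  then show ?thesis
    unfolding history_high_prob_def high_prob_learn_alg[OF solver n_def assms] played_def by simp
qed

text \<open>The identity of the probabilities holds below value 1; from 1 on both coefficients
  vanish.\<close>

lemma extra_prob_history:
  assumes "n \<le> t"
  shows "extra_prob v * history_high_prob \<pi> t \<omega> v = extra_prob v * played_by \<omega> v"
    and "extra_cost v * history_high_prob \<pi> t \<omega> v = extra_cost v * played_by \<omega> v"
  using history_high_prob_learn_alg[OF assms, of v] extra_prob_one[of v] extra_cost_eq_0_iff[of v]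
  by (cases "v < 1"; simp)+

lemma sum_high_prob_nonneg: "0 \<le> (\<Sum>v\<in>vals D. v * extra_prob v * mean_high_prob T \<pi> t v)" if "t < T"
  using mean_high_prob_bounds[OF pol that] extra_prob_bounds vals_range
  by (intro sum_nonneg mult_nonneg_nonneg) auto

lemma learn_alg_value_ge_base: "T * base_value \<le> exp_value D T \<pi>"
proof -
  have "(\<Sum>t<T. base_value) \<le> exp_value D T \<pi>"
    unfolding exp_value_eq[OF pol learn_alg_bid]
    by (intro sum_mono) (simp add: sum_high_prob_nonneg)
  then show ?thesis by simp
qed

text \<open>Each decision slot earns at least \<open>B - loss\<close> above
  \<open>base_value\<close> on the accurate event and at least 0 above it otherwise. So inaccuracy
  costs at most \<open>B\<close>, hence at most K, times its probability. High bids in the learning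
  slots are counted as 0.\<close>

lemma learn_alg_value_ge:
  fixes \<epsilon> B loss :: real
  assumes n: "n > 0" and \<epsilon>: "0 < \<epsilon>" and B: "0 \<le> B" "B \<le> K" and loss: "0 \<le> loss"
    and opt: "\<And>\<omega>. accurate n \<epsilon> (\<lambda>i. fst (\<omega> i)) \<Longrightarrow> (\<And>i. i < n \<Longrightarrow> fst (fst (\<omega> i)) \<in> vals D) \<Longrightarrow>
      B - loss \<le> (\<Sum>v\<in>vals D. v * extra_prob v * played_by \<omega> v)"
  shows "T * base_value + real (T - n) * (B - K * ((2 * K + 1) / (n * \<epsilon>\<^sup>2)) - loss) \<le> exp_value D T \<pi>"
proof -
  let ?bad = "(2 * K + 1) / (n * \<epsilon>\<^sup>2)" and ?m = "\<lambda>t v. v * extra_prob v * mean_high_prob T \<pi> t v"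
  have decision: "B - K * ?bad - loss \<le> (\<Sum>v\<in>vals D. ?m t v)" if t: "n \<le> t" "t < T" for t
  proof -
    let ?S = "slots D ({..<T} - {t})"
    let ?G = "{\<omega> \<in> space ?S. accurate n \<epsilon> (\<lambda>i. fst (\<omega> i))}"
    interpret S: prob_space ?S by (rule prob_space_slots)
    have I: "finite ({..<T} - {t})" "{..<n} \<subseteq> {..<T} - {t}" using t by auto
    have G: "?G \<in> sets ?S" by (rule accurate_measurable[OF I n \<epsilon>])
    have int: "integrable ?S (\<lambda>\<omega>. B * indicator ?G \<omega>)"
      using G by (intro integrable_mult_right integrable_real_indicator) (auto simp: S.emeasure_eq_measure)
    have GI: "?G \<inter> space ?S = ?G" by auto
    have "B - B * (1 - measure ?S ?G) \<ge> B - K * ?bad"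
      using prob_accurate[OF I n \<epsilon>] B by (intro diff_left_mono mult_mono) auto
    then have "B - K * ?bad - loss \<le> B * measure ?S ?G - loss" by (simp add: algebra_simps)
    also have "\<dots> = (\<integral>\<omega>. B * indicator ?G \<omega> - loss \<partial>?S)"
      using int by (subst Bochner_Integration.integral_diff) (auto simp: S.prob_space GI simp del: Int_Collect)
    also have "\<dots> \<le> (\<integral>\<omega>. (\<Sum>v\<in>vals D. v * extra_prob v * history_high_prob \<pi> t \<omega> v) \<partial>?S)"
    proof (rule integral_mono_AE)
      show "integrable ?S (\<lambda>\<omega>. B * indicator ?G \<omega> - loss)"
        using int by (intro Bochner_Integration.integrable_diff) auto
      show "integrable ?S (\<lambda>\<omega>. \<Sum>v\<in>vals D. v * extra_prob v * history_high_prob \<pi> t \<omega> v)"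
        by (intro Bochner_Integration.integrable_sum integrable_mult_right
            integrable_history_high_prob[OF pol t(2)])
      show "AE \<omega> in ?S. B * indicator ?G \<omega> - loss \<le>
          (\<Sum>v\<in>vals D. v * extra_prob v * history_high_prob \<pi> t \<omega> v)"
        using AE_slots_typical[OF I(1)]
      proof eventually_elim
        case (elim \<omega>)
        have vals: "fst (fst (\<omega> i)) \<in> vals D" if "i < n" for i
          using elim that I(2) by (auto simp: typical_def)
        have "0 \<le> (\<Sum>v\<in>vals D. v * extra_prob v * history_high_prob \<pi> t \<omega> v)"
          using extra_prob_bounds vals_range
          by (intro sum_nonneg mult_nonneg_nonneg) (auto simp: history_high_prob_def high_prob_bounds)
        moreover have "B - loss \<le> (\<Sum>v\<in>vals D. v * extra_prob v * history_high_prob \<pi> t \<omega> v)" if "\<omega> \<in> ?G"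
          using opt[of \<omega>] that vals unfolding mult.assoc extra_prob_history(1)[OF t(1)] by simp
        ultimately show ?case using loss by (auto split: split_indicator)
      qed
    qed
    also have "\<dots> = (\<Sum>v\<in>vals D. ?m t v)"
      unfolding mean_high_prob_def
      by (subst Bochner_Integration.integral_sum) (auto intro!: integrable_mult_right integrable_history_high_prob[OF pol t(2)])
    finally show ?thesis .
  qed
  have "real (T - n) * (B - K * ?bad - loss) = (\<Sum>t\<in>{n..<T}. B - K * ?bad - loss)" by simp
  also have "\<dots> \<le> (\<Sum>t\<in>{n..<T}. \<Sum>v\<in>vals D. ?m t v)"
    by (intro sum_mono decision) auto
  also have "\<dots> \<le> (\<Sum>t<T. \<Sum>v\<in>vals D. ?m t v)"
    by (intro sum_mono2) (auto intro: sum_high_prob_nonneg)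
  finally show ?thesis
    unfolding exp_value_eq[OF pol learn_alg_bid] by (simp add: sum.distrib)
qed

lemma measurable_total:
  assumes "is_policy T \<pi>'"
  shows "total_value T \<pi>' \<in> borel_measurable (slots D {..<T})"
    "total_payment T \<pi>' \<in> borel_measurable (slots D {..<T})"
  unfolding total_value_eq[abs_def] total_payment_eq[abs_def]
  by (intro borel_measurable_sum borel_measurable_integrable integrable_at_bid[OF assms]; simp)+

lemma rosc_given_measurable:
  "{h \<in> space (slots D {..<n}). rosc_given D T n \<pi> h} \<in> sets (slots D {..<n})"
proof -
  let ?R = "slots D {n..<T}"
  interpret R: prob_space ?R by (rule prob_space_slots)
  have un: "{..<n} \<union> {n..<T} = {..<T}" by (auto simp: n_def)
  have merge: "merge {..<n} {n..<T} \<in> slots D {..<n} \<Otimes>\<^sub>M ?R \<rightarrow>\<^sub>M slots D {..<T}"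
    using measurable_merge[of "{..<n}" "{n..<T}" "\<lambda>_. slot_dist"] by (simp only: slots_def un)
  have [measurable]:
    "(\<lambda>x. total_value T \<pi> (merge {..<n} {n..<T} x)) \<in> borel_measurable (slots D {..<n} \<Otimes>\<^sub>M ?R)"
    "(\<lambda>x. total_payment T \<pi> (merge {..<n} {n..<T} x)) \<in> borel_measurable (slots D {..<n} \<Otimes>\<^sub>M ?R)"
    by (intro measurable_compose[OF merge] measurable_total pol)+
  show ?thesis unfolding rosc_given_def by measurable
qed

text \<open>Conditioned on \<open>h\<close>, the surplus of the learning phase is the realised
  truthful surplus, exactly n times its empirical mean, while every decision slot contributes the
  same expected surplus.\<close>

lemma rosc_given_learn_alg:
  assumes h: "h \<in> space (slots D {..<n})" and n: "n > 0"
    and surplus: "0 \<le> n * emp_surplus n (\<lambda>i. fst (h i)) +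
      (T - n) * (surplus - (\<Sum>v\<in>vals D. extra_cost v * played_by h v))"
  shows "rosc_given D T n \<pi> h"
proof -
  let ?R = "slots D {n..<T}" and ?m = "\<lambda>\<omega>. merge {..<n} {n..<T} (h, \<omega>)"
  interpret R: prob_space ?R by (rule prob_space_slots)
  \<comment> \<open>The strategy of the first decision slot, which by \<open>learn_alg_cong\<close>
    is that of all later ones.\<close>
  define \<beta> where "\<beta> = \<pi> n (restrict h {..<n})"
  have "n < T" using n by (simp add: n_def)
  have "restrict h {..<n} \<in> space (\<Pi>\<^sub>M i\<in>{..<n}. (borel :: slot measure))"
    using h by (rule measurable_space[OF measurable_restrict_slots, rotated]) simp
  note \<beta> = measurable_policy_section[OF pol \<open>n < T\<close> this, folded \<beta>_def]
  have [measurable]: "(\<lambda>y::slot. \<beta> (fst (fst y)) (snd y)) \<in> borel_measurable borel"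
    using measurable_compose[OF _ \<beta>, of "\<lambda>y::slot. (fst (fst y), snd y)" borel] by simp
  have mv: "(\<lambda>y. value_at y (\<beta> (fst (fst y)) (snd y))) \<in> borel_measurable borel"
    and mp: "(\<lambda>y. pay_at y (\<beta> (fst (fst y)) (snd y))) \<in> borel_measurable borel"
    and ms: "(\<lambda>y. lp_surplus_at y (\<beta> (fst (fst y)) (snd y))) \<in> borel_measurable borel"
    by measurable
  have learning: "?m \<omega> t = h t" "bid \<pi> (?m \<omega>) t = fst (fst (h t))" if "t < n" for t \<omega>
    using that by (auto simp: bid_def merge_def learn_alg_learning n_def)
  have decision: "?m \<omega> t = \<omega> t" "bid \<pi> (?m \<omega>) t = \<beta> (fst (fst (\<omega> t))) (snd (\<omega> t))"
    if "t \<in> {n..<T}" for t \<omega>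
  proof -
    show "?m \<omega> t = \<omega> t" using that by (auto simp: merge_def)
    then show "bid \<pi> (?m \<omega>) t = \<beta> (fst (fst (\<omega> t))) (snd (\<omega> t))"
      using that unfolding bid_def \<beta>_def
      by (simp, intro learn_alg_cong) (auto simp: n_def merge_def)
  qed
  have split: "(\<Sum>t<T. F (?m \<omega> t) (bid \<pi> (?m \<omega>) t)) =
      (\<Sum>t<n. F (h t) (fst (fst (h t)))) + (\<Sum>t\<in>{n..<T}. F (\<omega> t) (\<beta> (fst (fst (\<omega> t))) (snd (\<omega> t))))"
    for F :: "slot \<Rightarrow> real \<Rightarrow> real" and \<omega>
  proof -
    have "{..<T} = {..<n} \<union> {n..<T}" and dis: "{..<n} \<inter> {n..<T} = {}" using \<open>n < T\<close> by auto
    then have "(\<Sum>t<T. F (?m \<omega> t) (bid \<pi> (?m \<omega>) t)) =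
        (\<Sum>t<n. F (?m \<omega> t) (bid \<pi> (?m \<omega>) t)) + (\<Sum>t\<in>{n..<T}. F (?m \<omega> t) (bid \<pi> (?m \<omega>) t))"
      by (metis (no_types, lifting) sum.union_disjoint[OF _ _ dis] finite_lessThan finite_atLeastLessThan)
    then show ?thesis using learning decision by simp
  qed
  have integral_total: "(\<integral>\<omega>. (\<Sum>t<T. F (?m \<omega> t) (bid \<pi> (?m \<omega>) t)) \<partial>?R) =
      (\<Sum>t<n. F (h t) (fst (fst (h t)))) +
      (T - n) * (\<integral>y. F y (\<beta> (fst (fst y)) (snd y)) \<partial>slot_dist)"
    if F: "(\<lambda>y. F y (\<beta> (fst (fst y)) (snd y))) \<in> borel_measurable borel"
      "\<And>y b. typical (fst y) \<Longrightarrow> \<bar>F y b\<bar> \<le> 1" for F :: "slot \<Rightarrow> real \<Rightarrow> real"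
  proof -
    have int: "integrable ?R (\<lambda>\<omega>. F (\<omega> t) (\<beta> (fst (fst (\<omega> t))) (snd (\<omega> t))))" if "t \<in> {n..<T}" for t
      using that
      by (intro integrable_bounded_slots[where B = 1] F(2)
          measurable_compose[OF measurable_slots_component F(1)]) auto
    have "(\<integral>\<omega>. (\<Sum>t<T. F (?m \<omega> t) (bid \<pi> (?m \<omega>) t)) \<partial>?R) =
        (\<Sum>t<n. F (h t) (fst (fst (h t)))) +
        (\<Sum>t\<in>{n..<T}. \<integral>\<omega>. F (\<omega> t) (\<beta> (fst (fst (\<omega> t))) (snd (\<omega> t))) \<partial>?R)"
      unfolding split using int
      by (subst Bochner_Integration.integral_add)
         (auto intro!: Bochner_Integration.integrable_sum simp: R.prob_space)
    also have "(\<Sum>t\<in>{n..<T}. \<integral>\<omega>. F (\<omega> t) (\<beta> (fst (fst (\<omega> t))) (snd (\<omega> t))) \<partial>?R) =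
        (\<Sum>t\<in>{n..<T}. \<integral>y. F y (\<beta> (fst (fst y)) (snd y)) \<partial>slot_dist)"
      by (intro sum.cong refl integral_slots_component F(1))
    finally show ?thesis by simp
  qed
  let ?val = "\<integral>y. value_at y (\<beta> (fst (fst y)) (snd y)) \<partial>slot_dist"
  let ?pay = "\<integral>y. pay_at y (\<beta> (fst (fst y)) (snd y)) \<partial>slot_dist"
  have "?val - ?pay = (\<integral>y. value_at y (\<beta> (fst (fst y)) (snd y)) - pay_at y (\<beta> (fst (fst y)) (snd y)) \<partial>slot_dist)"
    by (rule Bochner_Integration.integral_diff[symmetric])
       (rule integrable_bounded_slot[OF mv], erule abs_at_le(1),
        rule integrable_bounded_slot[OF mp], erule abs_at_le(2))
  also have "\<dots> = (\<integral>y. lp_surplus_at y (\<beta> (fst (fst y)) (snd y)) \<partial>slot_dist)"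
  proof (rule integral_cong_AE)
    show "AE y in slot_dist. value_at y (\<beta> (fst (fst y)) (snd y)) - pay_at y (\<beta> (fst (fst y)) (snd y)) =
        lp_surplus_at y (\<beta> (fst (fst y)) (snd y))"
      using AE_slot_typical
      by eventually_elim (rule surplus_at_eq, assumption, simp add: \<beta>_def learn_alg_bid)
  qed (use mv mp ms in \<open>auto simp: measurable_cong_sets[OF sets_slot_dist refl]
      simp del: sets_slot_dist\<close>)
  also have "\<dots> = surplus - (\<Sum>v\<in>vals D. extra_cost v * high_prob \<beta> v)"
    by (rule expectation_lp_surplus_at[OF \<beta>])
  also have "high_prob \<beta> = history_high_prob \<pi> n h"
    by (simp add: \<beta>_def history_high_prob_def)
  finally have rate: "?val - ?pay = surplus - (\<Sum>v\<in>vals D. extra_cost v * played_by h v)"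
    by (simp add: extra_prob_history)
  have "(\<Sum>t<n. value_at (h t) (fst (fst (h t)))) - (\<Sum>t<n. pay_at (h t) (fst (fst (h t)))) =
      (\<Sum>t<n. max 0 (fst (fst (h t)) - snd (fst (h t))))"
    unfolding sum_subtractf[symmetric]
    by (intro sum.cong) (auto simp: value_at_def pay_at_def alloc_def pay_def)
  also have "\<dots> = n * emp_surplus n (\<lambda>i. fst (h i))"
    using n by (simp add: empirical_def)
  finally have first: "(\<Sum>t<n. value_at (h t) (fst (fst (h t)))) - (\<Sum>t<n. pay_at (h t) (fst (fst (h t)))) =
      n * emp_surplus n (\<lambda>i. fst (h i))" .
  have "(\<integral>\<omega>. total_value T \<pi> (?m \<omega>) \<partial>?R) - (\<integral>\<omega>. total_payment T \<pi> (?m \<omega>) \<partial>?R) =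
      ((\<Sum>t<n. value_at (h t) (fst (fst (h t)))) + (T - n) * ?val) -
      ((\<Sum>t<n. pay_at (h t) (fst (fst (h t)))) + (T - n) * ?pay)"
    unfolding total_value_eq total_payment_eq
    by (simp only: integral_total[of value_at, OF mv abs_at_le(1)]
        integral_total[of pay_at, OF mp abs_at_le(2)])
  also have "\<dots> = n * emp_surplus n (\<lambda>i. fst (h i)) + (T - n) * (?val - ?pay)"
    using first by (simp add: algebra_simps)
  finally show ?thesis
    unfolding rosc_given_def using surplus rate by simp
qed

end

section \<open>Choice of the accuracy, and comparison with the benchmark\<close>

context
  fixes T :: nat and solve and n :: nat and \<eta> a \<epsilon> :: real
  assumes solver: "lp_solver n solve" and pol: "is_policy T (learn_alg solve T)"
    and n_def: "n = T div 2" and n: "n > 0"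
    and inst: "D \<in> instances K \<eta>" "\<eta> > 0"
    and a_def: "a = \<eta> ^ 3" and \<epsilon>_def: "\<epsilon> = a\<^sup>2 / (16 * (K + 1)\<^sup>2)"
begin

text \<open>The definition of \<epsilon> makes (K + 1)^2 \<epsilon> equal to a^2/16. Two powers of
  \<open>a\<close> are needed because the scaling loss K (K + 1) \<epsilon> / a must itself be a
  small fraction of \<open>a\<close>.\<close>

private lemma constants:
  shows "0 < a" "a \<le> 1" "0 < \<epsilon>" "16 * ((K + 1) * \<epsilon>) \<le> a\<^sup>2" "a\<^sup>2 \<le> a"
    and "16 * (K * (K + 1) * \<epsilon>) \<le> a\<^sup>2"
    and "surplus \<noteq> 0 \<Longrightarrow> a \<le> surplus"
    and "v \<in> vals D \<Longrightarrow> extra_prob v \<noteq> 0 \<Longrightarrow> a \<le> extra_prob v"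
proof -
  show a: "0 < a" using inst by (simp add: a_def)
  show a1: "a \<le> 1" unfolding a_def using instance_bounds(1)[OF inst] inst(2) by (intro power_le_one) auto
  show \<epsilon>: "0 < \<epsilon>" unfolding \<epsilon>_def using a by (simp add: add_pos_nonneg)
  show "a\<^sup>2 \<le> a" unfolding power2_eq_square using a a1 by (simp add: mult_left_le)
  have eq: "16 * ((real K + 1)\<^sup>2 * \<epsilon>) = a\<^sup>2"
    by (simp add: \<epsilon>_def add_pos_nonneg field_simps)
  have "(real K + 1) * 1 \<le> (real K + 1) * (real K + 1)" by (intro mult_left_mono) auto
  then have "(real K + 1) * \<epsilon> \<le> (real K + 1)\<^sup>2 * \<epsilon>"
    using \<epsilon> unfolding power2_eq_square by (intro mult_right_mono) auto
  then show "16 * ((K + 1) * \<epsilon>) \<le> a\<^sup>2" using eq by (simp add: add.commute)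
  have "real K * (real K + 1) \<le> (real K + 1)\<^sup>2" by (simp add: power2_eq_square algebra_simps)
  then have "real K * (real K + 1) * \<epsilon> \<le> (real K + 1)\<^sup>2 * \<epsilon>"
    using \<epsilon> by (intro mult_right_mono) auto
  then show "16 * (K * (K + 1) * \<epsilon>) \<le> a\<^sup>2" using eq by (simp add: algebra_simps)
  show "surplus \<noteq> 0 \<Longrightarrow> a \<le> surplus"
    unfolding a_def by (rule instance_bounds(2)[OF inst])
  show "v \<in> vals D \<Longrightarrow> extra_prob v \<noteq> 0 \<Longrightarrow> a \<le> extra_prob v"
  proof -
    assume v: "v \<in> vals D" "extra_prob v \<noteq> 0"
    have "a \<le> \<eta>\<^sup>2" unfolding a_def using inst(2) instance_bounds(1)[OF inst] by (intro power_decreasing) auto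
    also have "\<dots> \<le> extra_prob v" by (rule instance_bounds(3)[OF inst v])
    finally show ?thesis .
  qed
qed

lemma prob_rosc_given:
  "\<P>(h in slots D {..<n}. rosc_given D T n (learn_alg solve T) h) \<ge> 1 - (2 * K + 1) / (n * \<epsilon>\<^sup>2)"
proof -
  let ?S = "slots D {..<n}"
  interpret S: prob_space ?S by (rule prob_space_slots)
  have "1 - (2 * K + 1) / (n * \<epsilon>\<^sup>2) \<le> \<P>(h in ?S. accurate n \<epsilon> (\<lambda>i. fst (h i)))"
    using n constants(3) by (intro prob_accurate) auto
  also have "\<dots> \<le> \<P>(h in ?S. rosc_given D T n (learn_alg solve T) h)"
  proof (rule S.finite_measure_mono_AE)
    show "{h \<in> space ?S. rosc_given D T n (learn_alg solve T) h} \<in> sets ?S"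
      by (rule rosc_given_measurable[OF solver pol n_def])
    \<comment> \<open>Without true surplus the estimated budget must be exactly 0, which accuracy
      alone does not give; it holds because almost surely no sample is profitable.\<close>
    have no_surplus: "AE h in ?S. surplus = 0 \<longrightarrow> (\<forall>i<n. max 0 (fst (fst (h i)) - snd (fst (h i))) = 0)"
    proof (cases "surplus = 0")
      case True
      have "(\<lambda>y::slot. max 0 (fst (fst y) - snd (fst y))) \<in> borel_measurable borel" by measurable
      from measurable_sets_borel[OF this, of "{0}"]
      have meas: "{y \<in> space slot_dist. max 0 (fst (fst y) - snd (fst y)) = 0} \<in> sets slot_dist"
        by (simp only: sets_slot_dist space_slot_dist) (simp add: vimage_def)
      have slot: "AE y in slot_dist. max 0 (fst (fst y) - snd (fst y)) = 0"
      proof (rule DU.AE_pair_measure)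
        show "{y \<in> space slot_dist. max 0 (fst (fst y) - snd (fst y)) = 0} \<in> sets slot_dist"
          by (rule meas)
        show "AE z in D. AE u in U. max 0 (fst (fst (z, u)) - snd (fst (z, u))) = 0"
          using True unfolding surplus_eq_0_iff by eventually_elim simp
      qed
      have "AE h in ?S. \<forall>i\<in>{..<n}. max 0 (fst (fst (h i)) - snd (fst (h i))) = 0"
      proof (rule AE_finite_allI)
        fix i assume "i \<in> {..<n}"
        then show "AE h in ?S. max 0 (fst (fst (h i)) - snd (fst (h i))) = 0"
          unfolding slots_def using slot
          by (intro AE_PiM_component[where P = "\<lambda>y. max 0 (fst (fst y) - snd (fst y)) = 0"]) (auto, unfold_locales)
      qed simp
      then show ?thesis by eventually_elim auto
    qed simp
    have "AE h in ?S. h \<in> space ?S" by (rule AE_space)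
    then show "AE h in ?S. h \<in> {h \<in> space ?S. accurate n \<epsilon> (\<lambda>i. fst (h i))} \<longrightarrow>
        h \<in> {h \<in> space ?S. rosc_given D T n (learn_alg solve T) h}"
      using AE_slots_typical[of "{..<n}", simplified] no_surplus
    proof eventually_elim
      case (elim h)
      have "rosc_given D T n (learn_alg solve T) h" if acc: "accurate n \<epsilon> (\<lambda>i. fst (h i))"
      proof (rule rosc_given_learn_alg[OF solver pol n_def elim(1) n] , rule played_surplus_nonneg[OF acc])
        show "lp_feasible (estimates n (\<lambda>i. fst (h i))) (snd (solve (estimates n (\<lambda>i. fst (h i)))))"
          using lp_solverD(1)[OF solver] by (simp add: lp_optimal_def)
        show "fst (fst (h i)) \<in> vals D" if "i < n" for i
          using elim(2) that by (auto simp: typical_def)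
        show "emp_surplus n (\<lambda>i. fst (h i)) = 0" if "surplus = 0"
          using elim(3) that by (simp add: empirical_def)
        have K\<epsilon>: "real K * \<epsilon> \<ge> 0" using constants(3) by simp
        have "16 * (real K * \<epsilon>) + 16 * \<epsilon> \<le> a"
          using constants(4,5) by (simp add: algebra_simps)
        then have sum: "2 * (real K * \<epsilon>) + 3 * \<epsilon> \<le> a"
          using K\<epsilon> constants(3) by linarith
        then have "(2 * real K + 3) * \<epsilon> \<le> a" by (simp add: algebra_simps)
        then show "(2 * K + 3) * \<epsilon> \<le> surplus" if "surplus \<noteq> 0"
          using constants(7)[OF that] by simp
        have "\<epsilon> \<le> a" using sum K\<epsilon> constants(3) by linarith
        then show "\<epsilon> \<le> extra_prob v" if "v \<in> vals D" "extra_prob v \<noteq> 0" for v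
          using constants(8)[OF that] by simp
        \<comment> \<open>For odd \<open>T\<close> the decision phase has n + 1 slots, so n >= 1
          matters.\<close>
        show "T - n \<le> 2 * n" using n by (simp add: n_def)
      qed
      then show ?case using elim(1) by simp
    qed
  qed
  finally show ?thesis .
qed

lemma benchmark_le_learn_alg:
  assumes bench: "benchmark_policy T \<pi>" "rosc D T \<pi>"
    and bad: "K * ((2 * K + 1) / (n * \<epsilon>\<^sup>2)) \<le> a / 4"
  shows "exp_value D T \<pi> \<le> 2 * exp_value D T (learn_alg solve T)"
proof -
  let ?L = "exp_value D T (learn_alg solve T)"
  have polb: "is_policy T \<pi>" using bench(1) by (simp add: benchmark_policy_def)
  have T: "T > 0" using n by (simp add: n_def)
  define x where "x v = total_high_prob T \<pi> v / T" for v
  have x: "0 \<le> x v \<and> x v \<le> 1" for v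
    using total_high_prob_bounds[OF polb, of v] T by (simp add: x_def)
  define B where "B = (\<Sum>v\<in>vals D. v * extra_prob v * x v)"
  have scale: "(\<Sum>v\<in>vals D. c v * total_high_prob T \<pi> v) = T * (\<Sum>v\<in>vals D. c v * x v)" for c
    using T by (simp add: x_def sum_distrib_left)
  have total: "exp_value D T \<pi> \<le> T * base_value + T * B"
    using exp_value_le[OF bench(1)] scale[of "\<lambda>v. v * extra_prob v"] by (simp add: B_def)
  have "T * (\<Sum>v\<in>vals D. extra_cost v * x v) \<le> T * surplus"
    using exp_surplus_le[OF bench(1)] bench(2) scale[of extra_cost] by (simp add: rosc_def)
  then have cost: "(\<Sum>v\<in>vals D. extra_cost v * x v) \<le> surplus"
    using T by simp
  have base: "T * base_value \<le> ?L"
    by (rule learn_alg_value_ge_base[OF solver pol n_def])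
  have base_nonneg: "0 \<le> base_value" using surplus_nonneg surplus_le_base_value by linarith
  show ?thesis
  proof (cases "surplus = 0")
    case True
    have "(\<Sum>v\<in>vals D. extra_cost v * x v) = 0"
      using cost True extra_cost_nonneg x by (intro antisym sum_nonneg) auto
    then have "extra_cost v * x v = 0" if "v \<in> vals D" for v
      using that finite_vals extra_cost_nonneg x by (subst (asm) sum_nonneg_eq_0_iff) auto
    then have "B = 0"
      unfolding B_def by (intro sum.neutral) (auto simp: extra_cost_eq_0_iff)
    moreover have "0 \<le> T * base_value" using base_nonneg by simp
    ultimately show ?thesis using total base by simp
  next
    case False
    then have a: "a \<le> base_value" using constants(7) surplus_le_base_value by fastforce
    show ?thesis
    \<comment> \<open>If B is small, the base value \<open>a\<close> or more dominates it and
      truthful bidding alone earns half of the benchmark. Otherwise \<open>B - a / 2\<close> is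
      positive, as the monotonicity argument below requires.\<close>
    proof (cases "B \<le> a / 2")
      case True
      then have "T * B \<le> T * base_value" using a constants(1) by (intro mult_left_mono) auto
      then show ?thesis using total base by simp
    next
      case B: False
      let ?loss = "K * (K + 1) * \<epsilon> / a + 2 * K * \<epsilon>"
      have "real K * \<epsilon> \<ge> 0" using constants(3) by simp
      then have K\<epsilon>: "16 * (real K * \<epsilon>) \<le> a"
        using constants(3-5) by (simp add: algebra_simps)
      have "K * (K + 1) * \<epsilon> / a \<le> a / 16"
        using constants(1) constants(6) by (simp add: field_simps power2_eq_square)
      moreover have "2 * K * \<epsilon> = 2 * (real K * \<epsilon>)" by simp
      ultimately have loss: "?loss \<le> a / 4"
        using K\<epsilon> constants(1) by linarith
      have le_K: "B \<le> K"
      proof -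
        have "B \<le> (\<Sum>v\<in>vals D. 1)"
          unfolding B_def using extra_prob_bounds x vals_range
          by (intro sum_mono mult_le_one mult_nonneg_nonneg) auto
        then show ?thesis by (simp add: card_vals)
      qed
      let ?Y = "B - K * ((2 * K + 1) / (n * \<epsilon>\<^sup>2)) - ?loss"
      have learn: "T * base_value + real (T - n) * ?Y \<le> exp_value D T (learn_alg solve T)"
      proof (rule learn_alg_value_ge[OF solver pol n_def n constants(3) _ le_K])
        show "0 \<le> B" using B constants(1) by simp
        show "0 \<le> ?loss" using constants(1,3) by simp
        show "B - ?loss \<le> (\<Sum>v\<in>vals D. v * extra_prob v *
            played n (\<lambda>i. fst (\<omega> i)) (snd (solve (estimates n (\<lambda>i. fst (\<omega> i))))) v)"
          if "accurate n \<epsilon> (\<lambda>i. fst (\<omega> i))" "\<And>i. i < n \<Longrightarrow> fst (fst (\<omega> i)) \<in> vals D" for \<omega>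
          unfolding B_def
          using that lp_solverD(1)[OF solver] constants(1,3-5) constants(7)[OF False] x cost
          by (intro played_near_optimal) (auto simp: algebra_simps)
      qed
      have "T / 2 * (B - a / 2) \<le> real (T - n) * (B - a / 2)"
        using B by (intro mult_right_mono) (auto simp: n_def)
      \<comment> \<open>The deficit a/2 is a/4 for inaccurate estimates plus a/4 for the loss of the
        estimated optimum.\<close>
      also have "\<dots> \<le> real (T - n) * ?Y"
        using bad loss by (intro mult_left_mono) auto
      finally have "T * base_value + T / 2 * (B - a / 2) \<le> exp_value D T (learn_alg solve T)"
        using learn by linarith
      \<comment> \<open>Doubling turns the deficit into T a/2, and the second copy of
        \<open>T * base_value\<close> covers it.\<close>
      moreover have "T * a \<le> T * base_value" using a by (intro mult_left_mono) auto
      moreover have "0 \<le> T * a" using constants(1) by simp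
      ultimately show ?thesis using total by (simp add: algebra_simps)
    qed
  qed
qed

lemma OPT_le_learn_alg:
  assumes "K * ((2 * K + 1) / (n * \<epsilon>\<^sup>2)) \<le> a / 4"
  shows "OPT D T \<le> 2 * exp_value D T (learn_alg solve T)"
  unfolding OPT_def using truthful_benchmark benchmark_le_learn_alg assms
  by (intro cSUP_least) auto

end

end

text \<open>The two requirements amount to sqrt T >= c/(K L) and T >= 4 K c/a; the summand 2 in the
  witness keeps the learning phase nonempty.\<close>

lemma deviation_rate:
  fixes K :: nat and a c L :: real
  assumes "K > 0" "a > 0" "c > 0" "L > 0"
  obtains T\<^sub>0 :: nat where "T\<^sub>0 \<ge> 2"
    "\<And>T. T \<ge> T\<^sub>0 \<Longrightarrow> c / T \<le> K * L / sqrt T \<and> K * (c / T) \<le> a / 4"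
proof
  let ?T0 = "2 + nat \<lceil>4 * K * c / a\<rceil> + nat \<lceil>(c / (K * L))\<^sup>2\<rceil>"
  show "?T0 \<ge> 2" by simp
  fix T assume T: "T \<ge> ?T0"
  then have pos: "real T > 0" by simp
  have "(c / (K * L))\<^sup>2 \<le> T" using T by linarith
  then have "c / (K * L) \<le> sqrt T" by (rule real_le_rsqrt)
  then have "c \<le> K * L * sqrt T" using assms by (simp add: field_simps)
  then have "c / T \<le> K * L * sqrt T / T" using pos by (intro divide_right_mono) auto
  also have "\<dots> = K * L / sqrt T" using pos by (simp add: field_simps)
  finally have 1: "c / T \<le> K * L / sqrt T" .
  have "4 * K * c / a \<le> T" using T by linarith
  then have "K * (c / T) \<le> a / 4" using assms pos by (simp add: field_simps)
  with 1 show "c / T \<le> K * L / sqrt T \<and> K * (c / T) \<le> a / 4" ..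
qed

theorem theorem19:
  "\<exists>C>0. \<forall>(K::nat) (\<eta>::real) (\<delta>\<^sub>0::real). \<eta> > 0 \<and> \<delta>\<^sub>0 < 1 \<longrightarrow>
     (\<exists>T\<^sub>0. \<forall>T\<ge>T\<^sub>0. \<forall>solve \<delta>.
        lp_solver (T div 2) solve \<and> is_policy T (learn_alg solve T) \<and> 0 < \<delta> \<and> \<delta> \<le> \<delta>\<^sub>0 \<longrightarrow>
          competitive_ratio (instances K \<eta>) T (learn_alg solve T)
            \<ge> ereal (1 / 2 - C * (real K * ln (1 / \<delta>) / sqrt (real T))) \<and>
          (\<forall>D\<in>instances K \<eta>.
             \<P>(h in slots D {..<T div 2}. rosc_given D T (T div 2) (learn_alg solve T) h)
               \<ge> 1 - C * (real K * ln (1 / \<delta>) / sqrt (real T))))"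
proof (rule exI[of _ 1], intro conjI allI impI, goal_cases)
  case (2 K \<eta> \<delta>\<^sub>0)
  then have \<eta>: "\<eta> > 0" and \<delta>\<^sub>0: "\<delta>\<^sub>0 < 1" by auto
  define a where "a = \<eta> ^ 3"
  define \<epsilon> where "\<epsilon> = a\<^sup>2 / (16 * (real K + 1)\<^sup>2)"
  \<comment> \<open>The factor 3 converts n to T through T <= 3n, which is attained at T =
    3.\<close>
  define c where "c = 3 * (2 * real K + 1) / \<epsilon>\<^sup>2"
  \<comment> \<open>A positive lower bound on ln(1/\<delta>) for all admissible \<delta>, so that
    the threshold on \<open>T\<close> can precede \<delta>. For
    \<open>\<delta>\<^sub>0 \<le> 0\<close> no \<delta> is admissible and any positive number
    serves.\<close>
  define L where "L = (if \<delta>\<^sub>0 > 0 then ln (1 / \<delta>\<^sub>0) else 1)"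
  have a: "a > 0" using \<eta> by (simp add: a_def)
  then have \<epsilon>: "\<epsilon> > 0" by (simp add: \<epsilon>_def add_nonneg_pos)
  then have c: "c > 0" by (simp add: c_def add_nonneg_pos)
  have L: "L > 0" using \<delta>\<^sub>0 by (simp add: L_def)
  \<comment> \<open>The threshold on \<open>T\<close> is chosen before any instance is given. For K
    = 0 the class is empty, and for every instance \<open>K_pos\<close> identifies the maximum with
    K.\<close>
  have K1: "max 1 K > 0" by simp
  obtain T\<^sub>0 :: nat where T\<^sub>0: "T\<^sub>0 \<ge> 2"
    "\<And>T. T \<ge> T\<^sub>0 \<Longrightarrow> c / T \<le> max 1 K * L / sqrt T \<and> max 1 K * (c / T) \<le> a / 4"
    using deviation_rate[OF K1 a c L] by blast
  show ?case
  proof (intro exI[of _ T\<^sub>0] allI impI, elim conjE)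
    fix T solve \<delta>
    assume T: "T\<^sub>0 \<le> T" and solver: "lp_solver (T div 2) solve"
      and pol: "is_policy T (learn_alg solve T)" and \<delta>: "0 < \<delta>" "\<delta> \<le> \<delta>\<^sub>0"
    define n where "n = T div 2"
    have n: "n > 0" "T \<le> 3 * n" using T T\<^sub>0(1) by (auto simp: n_def)
    have L_le: "L \<le> ln (1 / \<delta>)" using \<delta> by (simp add: L_def frac_le)
    let ?O = "1 * (real K * ln (1 / \<delta>) / sqrt (real T))"
    have O: "0 \<le> ?O" using L L_le by simp
    have main: "OPT D T \<le> 2 * exp_value D T (learn_alg solve T) \<and>
        \<P>(h in slots D {..<n}. rosc_given D T n (learn_alg solve T) h) \<ge> 1 - ?O"
      if inst: "D \<in> instances K \<eta>" for D
    proof -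
      interpret auction K D using inst by unfold_locales (simp add: instances_def)
      have K: "max 1 K = K" using K_pos by simp
      have e: "\<epsilon> = a\<^sup>2 / real (16 * (K + 1)\<^sup>2)" by (simp add: \<epsilon>_def add.commute)
      have bad: "(2 * K + 1) / (n * \<epsilon>\<^sup>2) \<le> c / T"
      proof -
        have "(2 * K + 1) / (n * \<epsilon>\<^sup>2) = c / (3 * n)"
          using n \<epsilon> by (simp add: c_def field_simps)
        also have "\<dots> \<le> c / T" using n T T\<^sub>0(1) c by (intro divide_left_mono) auto
        finally show ?thesis .
      qed
      have "K * ((2 * K + 1) / (n * \<epsilon>\<^sup>2)) \<le> K * (c / T)"
        using bad by (intro mult_left_mono) auto
      also have "\<dots> \<le> a / 4" using T\<^sub>0(2)[OF T] K by simp
      finally have opt: "OPT D T \<le> 2 * exp_value D T (learn_alg solve T)"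
        using OPT_le_learn_alg[OF _ pol _ n(1) inst \<eta> a_def e] solver by (simp add: n_def)
      have "c / T \<le> K * L / sqrt T" using T\<^sub>0(2)[OF T] K by simp
      also have "\<dots> \<le> ?O" using L_le by (simp add: divide_right_mono mult_left_mono)
      finally have "1 - ?O \<le> 1 - (2 * K + 1) / (n * \<epsilon>\<^sup>2)" using bad by simp
      also have "\<dots> \<le> \<P>(h in slots D {..<n}. rosc_given D T n (learn_alg solve T) h)"
        using prob_rosc_given[OF _ pol _ n(1) inst \<eta> a_def e] solver by (simp add: n_def)
      finally show ?thesis using opt by simp
    qed
    have "ereal (1 / 2 - ?O) \<le> competitive_ratio (instances K \<eta>) T (learn_alg solve T)"
      unfolding competitive_ratio_def
    proof (rule INF_greatest)
      fix D assume "D \<in> {D \<in> instances K \<eta>. OPT D T > 0}"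
      then have "1 / 2 \<le> exp_value D T (learn_alg solve T) / OPT D T"
        using main[of D] by (simp add: field_simps)
      then show "ereal (1 / 2 - ?O) \<le> ereal (exp_value D T (learn_alg solve T) / OPT D T)"
        using O unfolding ereal_less_eq by linarith
    qed
    then show "competitive_ratio (instances K \<eta>) T (learn_alg solve T) \<ge> ereal (1 / 2 - ?O) \<and>
        (\<forall>D\<in>instances K \<eta>.
           \<P>(h in slots D {..<T div 2}. rosc_given D T (T div 2) (learn_alg solve T) h) \<ge> 1 - ?O)"
      using main by (simp add: n_def)
  qed
qed simp

end
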